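(* Let $\Sigma$ be a locally finite relational signature, let $\mathbf{K}$ be a local class of $\Sigma$-structures, and let $F$ be the Fra\"iss\'e limit of $\mathbf{K}$. For each $N\in\mathbb{N}$ let $\mu_N$ be the frame-wise uniform measure on $\mathbf{K}^N$. Then for every first-order sentence $\phi$ over $\Sigma$, the sequence $\mu_N(\{S\in\mathbf{K}^N : S\models\phi\})$ converges as $N\to\infty$, and its limit is $1$ if $F\models\phi$ and $0$ if $F\not\models\phi$.
   Context: A relational signature $\Sigma$ is locally finite if for each $n$ it contains only finitely many $n$-ary relation symbols. For a $\Sigma$-structure $M$, $|M|$ denotes its underlying set and $\|M\|$ its cardinality. The General Irreflexivity axioms $\Phi^\Sigma_{GI}$ are: for every $R\in\Sigma$ of arity $n\ge 2$ and all distinct $i,j\in\{1,\dots,n\}$, $\forall x_1\cdots\forall x_n\,(R(x_1,\dots,x_n)\to x_i\neq x_j)$. A local sentence is a sentence of the form $\forall x_1\cdots\forall x_m\,(R(x_1,\dots,x_m)\to\psi)$ with $m>0$, $R\in\Sigma$ of arity $m$ and $\psi$ quantifier-free. For a set $\Phi$ of sentences, $\mathrm{Mod}\,\Phi$ is the class of all finite $\Sigma$-structures $M$ with $|M|\subseteq\mathbb{N}$ and $M\models\Phi$. A local class is a class $\mathbf{K}=\mathrm{Mod}\,\Phi$ where $\Sigma$ is locally finite and $\Phi\supseteq\Phi^\Sigma_{GI}$ is a set of local sentences. Substructures are induced substructures; $A\restriction X$ is the induced substructure on $X$. For $n\ge 0$, the $n$-frame $A^{(n)}$ of a structure $A$ has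 the same underlying set, the same interpretations of all relations of arity $\le n$, and empty interpretations of all relations of arity $>n$. The Fra\"iss\'e limit of $\mathbf{K}$ is the (unique up to isomorphism) countable $\Sigma$-structure $F$ whose age (the class of finite structures embeddable in $F$) is $\mathbf{K}$ up to isomorphism and which is weakly homogeneous: for every finite $B$ embeddable in $F$, every substructure $A$ of $B$ and every embedding $f:A\to F$, there is an embedding $g:B\to F$ extending $f$. Measures: for $N\in\mathbb{N}$, $\mathbf{K}^N$ is the set of members of $\mathbf{K}$ with underlying set $\{0,\dots,N-1\}$ and $\mathbf{K}^{\subset N}$ the set of members of $\mathbf{K}$ with underlying set a subset of $\{0,\dots,N-1\}$; $\mathbf{K}^{\subset\infty}=\mathbf{K}$, and $\mathbf{K}^\infty$ is the set of $\Sigma$-structures with underlying set $\mathbb{N}$ satisfying $\Phi$. For $i\in\mathbb{N}\cup\{\infty\}$, $A\in\mathbf{K}^{\subset i}$ and $k\in\mathbb{N}$, let $O_i(A,k)=\{S\in\mathbf{K}^i : (S\restriction|A|)^{(k)}=A^{(k)}\}$. For $S\in\mathbf{K}$, $N(S,k)$ is the number of distinct $(k+1)$-frames of structures $T\in\mathbf{K}$ with $|T|=|S|$ and $T^{(k)}=S^{(k)}$. Define $\mu_i(O_i(A,0))=1$ and $\mu_i(O_i(A,k+1))=\mu_i(O_i(A,k))/N(A,k)$. This is finitely additive on the ring generated by the sets $O_i(A,k)$ and induces a probability measure $\mu_i$ on $\mathbf{K}^i$ (for finite $i$, on all subsets of the finite set $\mathbf{K}^i$; for $i=\infty$, via Carath\'eodory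 extension from the base of clopen sets $O_\infty(A,k)$), called the frame-wise uniform measure. *)

theory Defs
  imports "HOL-Analysis.Analysis"
begin

section \<open>Relational structures\<close>

datatype 'r signature = Signature (symbols: "'r set") (arity: "'r \<Rightarrow> nat")

definition locally_finite :: "'r signature \<Rightarrow> bool" where
  "locally_finite \<Sigma> \<longleftrightarrow> (\<forall>n. finite {R \<in> symbols \<Sigma>. arity \<Sigma> R = n})"

datatype ('r, 'a) struct = Struct (universe: "'a set") (interp: "'r \<Rightarrow> 'a list set")

text \<open>Symbols outside the signature get the empty interpretation, so that structures are
  determined by their universe and the relations named by the signature. The universe may be
  empty.\<close>

definition is_structure :: "'r signature \<Rightarrow> ('r, 'a) struct \<Rightarrow> bool" where
  "is_structure \<Sigma> M \<longleftrightarrow>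
     (\<forall>R \<in> symbols \<Sigma>. \<forall>xs \<in> interp M R. length xs = arity \<Sigma> R \<and> set xs \<subseteq> universe M) \<and>
     (\<forall>R. R \<notin> symbols \<Sigma> \<longrightarrow> interp M R = {})"

definition induced :: "('r, 'a) struct \<Rightarrow> 'a set \<Rightarrow> ('r, 'a) struct" where
  "induced M X = Struct (universe M \<inter> X) (\<lambda>R. {xs \<in> interp M R. set xs \<subseteq> X})"

definition substructure :: "('r, 'a) struct \<Rightarrow> ('r, 'a) struct \<Rightarrow> bool" where
  "substructure A B \<longleftrightarrow> universe A \<subseteq> universe B \<and> A = induced B (universe A)"

definition frame :: "'r signature \<Rightarrow> nat \<Rightarrow> ('r, 'a) struct \<Rightarrow> ('r, 'a) struct" where
  "frame \<Sigma> n A = Struct (universe A) (\<lambda>R. if arity \<Sigma> R \<le> n then interp A R else {})"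

definition embedding ::
    "'r signature \<Rightarrow> ('r, 'a) struct \<Rightarrow> ('r, 'b) struct \<Rightarrow> ('a \<Rightarrow> 'b) \<Rightarrow> bool" where
  "embedding \<Sigma> A B f \<longleftrightarrow>
     inj_on f (universe A) \<and> f ` universe A \<subseteq> universe B \<and>
     (\<forall>R \<in> symbols \<Sigma>. \<forall>xs. set xs \<subseteq> universe A \<and> length xs = arity \<Sigma> R \<longrightarrow>
        (xs \<in> interp A R \<longleftrightarrow> map f xs \<in> interp B R))"

definition embeddable :: "'r signature \<Rightarrow> ('r, 'a) struct \<Rightarrow> ('r, 'b) struct \<Rightarrow> bool" where
  "embeddable \<Sigma> A B \<longleftrightarrow> (\<exists>f. embedding \<Sigma> A B f)"

definition isomorphic :: "'r signature \<Rightarrow> ('r, 'a) struct \<Rightarrow> ('r, 'b) struct \<Rightarrow> bool" where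
  "isomorphic \<Sigma> A B \<longleftrightarrow> (\<exists>f. embedding \<Sigma> A B f \<and> f ` universe A = universe B)"

section \<open>First-order logic\<close>

datatype 'r form =
    Falsum
  | Eq nat nat
  | Rel 'r "nat list"
  | Neg "'r form"
  | Conj "'r form" "'r form"
  | Disj "'r form" "'r form"
  | Imp "'r form" "'r form"
  | Forall nat "'r form"
  | Exists nat "'r form"

primrec form_over :: "'r signature \<Rightarrow> 'r form \<Rightarrow> bool" where
  "form_over \<Sigma> Falsum \<longleftrightarrow> True"
| "form_over \<Sigma> (Eq i j) \<longleftrightarrow> True"
| "form_over \<Sigma> (Rel R is) \<longleftrightarrow> R \<in> symbols \<Sigma> \<and> length is = arity \<Sigma> R"
| "form_over \<Sigma> (Neg p) \<longleftrightarrow> form_over \<Sigma> p"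
| "form_over \<Sigma> (Conj p q) \<longleftrightarrow> form_over \<Sigma> p \<and> form_over \<Sigma> q"
| "form_over \<Sigma> (Disj p q) \<longleftrightarrow> form_over \<Sigma> p \<and> form_over \<Sigma> q"
| "form_over \<Sigma> (Imp p q) \<longleftrightarrow> form_over \<Sigma> p \<and> form_over \<Sigma> q"
| "form_over \<Sigma> (Forall i p) \<longleftrightarrow> form_over \<Sigma> p"
| "form_over \<Sigma> (Exists i p) \<longleftrightarrow> form_over \<Sigma> p"

primrec free_vars :: "'r form \<Rightarrow> nat set" where
  "free_vars Falsum = {}"
| "free_vars (Eq i j) = {i, j}"
| "free_vars (Rel R is) = set is"
| "free_vars (Neg p) = free_vars p"
| "free_vars (Conj p q) = free_vars p \<union> free_vars q"
| "free_vars (Disj p q) = free_vars p \<union> free_vars q"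
| "free_vars (Imp p q) = free_vars p \<union> free_vars q"
| "free_vars (Forall i p) = free_vars p - {i}"
| "free_vars (Exists i p) = free_vars p - {i}"

primrec quantifier_free :: "'r form \<Rightarrow> bool" where
  "quantifier_free Falsum \<longleftrightarrow> True"
| "quantifier_free (Eq i j) \<longleftrightarrow> True"
| "quantifier_free (Rel R is) \<longleftrightarrow> True"
| "quantifier_free (Neg p) \<longleftrightarrow> quantifier_free p"
| "quantifier_free (Conj p q) \<longleftrightarrow> quantifier_free p \<and> quantifier_free q"
| "quantifier_free (Disj p q) \<longleftrightarrow> quantifier_free p \<and> quantifier_free q"
| "quantifier_free (Imp p q) \<longleftrightarrow> quantifier_free p \<and> quantifier_free q"
| "quantifier_free (Forall i p) \<longleftrightarrow> False"
| "quantifier_free (Exists i p) \<longleftrightarrow> False"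

definition sentence :: "'r signature \<Rightarrow> 'r form \<Rightarrow> bool" where
  "sentence \<Sigma> p \<longleftrightarrow> form_over \<Sigma> p \<and> free_vars p = {}"

primrec sat :: "('r, 'a) struct \<Rightarrow> (nat \<Rightarrow> 'a) \<Rightarrow> 'r form \<Rightarrow> bool" where
  "sat M e Falsum \<longleftrightarrow> False"
| "sat M e (Eq i j) \<longleftrightarrow> e i = e j"
| "sat M e (Rel R is) \<longleftrightarrow> map e is \<in> interp M R"
| "sat M e (Neg p) \<longleftrightarrow> \<not> sat M e p"
| "sat M e (Conj p q) \<longleftrightarrow> sat M e p \<and> sat M e q"
| "sat M e (Disj p q) \<longleftrightarrow> sat M e p \<or> sat M e q"
| "sat M e (Imp p q) \<longleftrightarrow> (sat M e p \<longrightarrow> sat M e q)"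
| "sat M e (Forall i p) \<longleftrightarrow> (\<forall>a \<in> universe M. sat M (e(i := a)) p)"
| "sat M e (Exists i p) \<longleftrightarrow> (\<exists>a \<in> universe M. sat M (e(i := a)) p)"

text \<open>Assignments are arbitrary functions into the ambient type, not only into the universe.
  The truth value of a sentence does not depend on the assignment, and this way it is the
  intended one for the empty structure as well.\<close>

definition models :: "('r, 'a) struct \<Rightarrow> 'r form \<Rightarrow> bool" (infix "\<TTurnstile>" 50) where
  "M \<TTurnstile> p \<longleftrightarrow> (\<forall>e. sat M e p)"

lemma sat_cong: "(\<And>i. i \<in> free_vars p \<Longrightarrow> e i = e' i) \<Longrightarrow> sat M e p \<longleftrightarrow> sat M e' p"
proof (induction p arbitrary: e e')
  case (Rel R xs)
  then have "map e xs = map e' xs" by simp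
  then show ?case by (simp only: sat.simps)
next
  case (Forall i p)
  have "sat M (e(i := a)) p \<longleftrightarrow> sat M (e'(i := a)) p" for a
    by (rule Forall.IH) (use Forall.prems in auto)
  then show ?case by simp
next
  case (Exists i p)
  have "sat M (e(i := a)) p \<longleftrightarrow> sat M (e'(i := a)) p" for a
    by (rule Exists.IH) (use Exists.prems in auto)
  then show ?case by simp
next
  case (Neg p)
  have "sat M e p \<longleftrightarrow> sat M e' p" by (rule Neg.IH) (use Neg.prems in auto)
  then show ?case by simp
next
  case (Conj p q)
  have "sat M e p \<longleftrightarrow> sat M e' p" by (rule Conj.IH(1)) (use Conj.prems in auto)
  moreover have "sat M e q \<longleftrightarrow> sat M e' q" by (rule Conj.IH(2)) (use Conj.prems in auto)
  ultimately show ?case by simp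
next
  case (Disj p q)
  have "sat M e p \<longleftrightarrow> sat M e' p" by (rule Disj.IH(1)) (use Disj.prems in auto)
  moreover have "sat M e q \<longleftrightarrow> sat M e' q" by (rule Disj.IH(2)) (use Disj.prems in auto)
  ultimately show ?case by simp
next
  case (Imp p q)
  have "sat M e p \<longleftrightarrow> sat M e' p" by (rule Imp.IH(1)) (use Imp.prems in auto)
  moreover have "sat M e q \<longleftrightarrow> sat M e' q" by (rule Imp.IH(2)) (use Imp.prems in auto)
  ultimately show ?case by simp
qed simp_all

lemma models_sentence: "sentence \<Sigma> p \<Longrightarrow> M \<TTurnstile> p \<longleftrightarrow> sat M e p"
  unfolding models_def sentence_def using sat_cong[of p] by blast

section \<open>Local classes\<close>

definition forall_list :: "nat list \<Rightarrow> 'r form \<Rightarrow> 'r form" where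
  "forall_list xs p = foldr Forall xs p"

definition general_irreflexivity :: "'r signature \<Rightarrow> 'r form set" where
  "general_irreflexivity \<Sigma> =
     {forall_list [0..<arity \<Sigma> R] (Imp (Rel R [0..<arity \<Sigma> R]) (Neg (Eq i j))) | R i j.
        R \<in> symbols \<Sigma> \<and> arity \<Sigma> R \<ge> 2 \<and> i < arity \<Sigma> R \<and> j < arity \<Sigma> R \<and> i \<noteq> j}"

definition local_sentence :: "'r signature \<Rightarrow> 'r form \<Rightarrow> bool" where
  "local_sentence \<Sigma> p \<longleftrightarrow> sentence \<Sigma> p \<and>
     (\<exists>R xs q. R \<in> symbols \<Sigma> \<and> arity \<Sigma> R > 0 \<and> length xs = arity \<Sigma> R \<and> distinct xs \<and>
        quantifier_free q \<and> p = forall_list xs (Imp (Rel R xs) q))"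

definition Mod :: "'r signature \<Rightarrow> 'r form set \<Rightarrow> ('r, nat) struct set" where
  "Mod \<Sigma> \<Phi> = {M. is_structure \<Sigma> M \<and> finite (universe M) \<and> (\<forall>p \<in> \<Phi>. M \<TTurnstile> p)}"

definition local_class :: "'r signature \<Rightarrow> ('r, nat) struct set \<Rightarrow> bool" where
  "local_class \<Sigma> K \<longleftrightarrow> locally_finite \<Sigma> \<and>
     (\<exists>\<Phi>. general_irreflexivity \<Sigma> \<subseteq> \<Phi> \<and> (\<forall>p \<in> \<Phi>. local_sentence \<Sigma> p) \<and> K = Mod \<Sigma> \<Phi>)"

section \<open>Fraisse limits\<close>

text \<open>Every finite structure is isomorphic to one whose universe consists of natural numbers,
  so it suffices to let the finite structures below range over the latter.\<close>

definition age :: "'r signature \<Rightarrow> ('r, 'a) struct \<Rightarrow> ('r, nat) struct set" where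
  "age \<Sigma> F = {B. is_structure \<Sigma> B \<and> finite (universe B) \<and> embeddable \<Sigma> B F}"

definition weakly_homogeneous :: "'r signature \<Rightarrow> ('r, 'a) struct \<Rightarrow> bool" where
  "weakly_homogeneous \<Sigma> F \<longleftrightarrow>
     (\<forall>B \<in> age \<Sigma> F. \<forall>A f. substructure A B \<and> embedding \<Sigma> A F f \<longrightarrow>
        (\<exists>g. embedding \<Sigma> B F g \<and> (\<forall>x \<in> universe A. g x = f x)))"

definition fraisse_limit ::
    "'r signature \<Rightarrow> ('r, nat) struct set \<Rightarrow> ('r, 'a) struct \<Rightarrow> bool" where
  "fraisse_limit \<Sigma> K F \<longleftrightarrow>
     is_structure \<Sigma> F \<and> countable (universe F) \<and>
     (\<forall>B \<in> age \<Sigma> F. \<exists>M \<in> K. isomorphic \<Sigma> B M) \<and>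
     (\<forall>M \<in> K. \<exists>B \<in> age \<Sigma> F. isomorphic \<Sigma> M B) \<and>
     weakly_homogeneous \<Sigma> F"

section \<open>The frame-wise uniform measure\<close>

definition on_size :: "('r, nat) struct set \<Rightarrow> nat \<Rightarrow> ('r, nat) struct set" where
  "on_size K N = {S \<in> K. universe S = {..<N}}"

definition within_size :: "('r, nat) struct set \<Rightarrow> nat \<Rightarrow> ('r, nat) struct set" where
  "within_size K N = {S \<in> K. universe S \<subseteq> {..<N}}"

definition frame_cylinder ::
    "'r signature \<Rightarrow> ('r, nat) struct set \<Rightarrow> nat \<Rightarrow> ('r, nat) struct \<Rightarrow> nat \<Rightarrow> ('r, nat) struct set"
  where
  "frame_cylinder \<Sigma> K N A k =
     {S \<in> on_size K N. frame \<Sigma> k (induced S (universe A)) = frame \<Sigma> k A}"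

definition num_frames ::
    "'r signature \<Rightarrow> ('r, nat) struct set \<Rightarrow> ('r, nat) struct \<Rightarrow> nat \<Rightarrow> nat" where
  "num_frames \<Sigma> K S k =
     card {frame \<Sigma> (k + 1) T | T. T \<in> K \<and> universe T = universe S \<and> frame \<Sigma> k T = frame \<Sigma> k S}"

primrec frame_weight ::
    "'r signature \<Rightarrow> ('r, nat) struct set \<Rightarrow> ('r, nat) struct \<Rightarrow> nat \<Rightarrow> real" where
  "frame_weight \<Sigma> K A 0 = 1"
| "frame_weight \<Sigma> K A (Suc k) = frame_weight \<Sigma> K A k / real (num_frames \<Sigma> K A k)"

text \<open>For a local class, the cylinders on \<open>{..<N}\<close> include all singletons
  (general irreflexivity makes the relations of arity greater than \<open>N\<close> empty), hence the generated
  sigma-algebra is the full power set of the finite set \<open>on_size K N\<close>.\<close>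

definition framewise_uniform ::
    "'r signature \<Rightarrow> ('r, nat) struct set \<Rightarrow> nat \<Rightarrow> ('r, nat) struct measure" where
  "framewise_uniform \<Sigma> K N =
     extend_measure (on_size K N) (within_size K N \<times> UNIV)
       (\<lambda>(A, k). frame_cylinder \<Sigma> K N A k) (\<lambda>(A, k). ennreal (frame_weight \<Sigma> K A k))"

end

theory Submission
  imports Defs
begin

text \<open>In a local class, the relations of arity \<open>card X\<close> on a finite set \<open>X\<close> can be chosen independently
  for different \<open>X\<close>, from a set of options (\<open>opts\<close>) that depends only on the structure on the proper
  subsets of \<open>X\<close>. The frame-wise uniform measure makes these choices uniformly, so a structure has
  weight \<open>\<Prod>X. 1 / card (opts S X)\<close>. Given the structure on a set of fewer than \<open>r\<close> points, distinct
  further points realise a prescribed one-point extension independently, each with probability at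
  least some \<open>p > 0\<close> depending only on \<open>r\<close>. Hence the one-point extension axioms up to size \<open>r\<close> fail
  with probability \<open>O(N ^ r * (1 - p) ^ (N - r))\<close>. The Fraisse limit satisfies all of them, and a
  back-and-forth argument shows that structures satisfying them up to size \<open>r\<close> agree on sentences
  of quantifier rank at most \<open>r\<close>.\<close>

section \<open>A limit of real sequences and the finite union bound\<close>

text \<open>After shifting \<open>N\<close> by \<open>r\<close>, the expression is the
  \<open>r\<close>-th power of \<open>(real (N + r) + 1) * d ^ N\<close>, where \<open>d\<close> is
  the \<open>r\<close>-th root of \<open>c\<close>, and this base tends to 0. For
  \<open>r = 0\<close>, where there is no root to take, only the convergence of \<open>c ^ N\<close>
  is left.\<close>

lemma polynomial_times_power_tendsto_0:
  fixes c :: real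
  assumes "0 \<le> c" "c < 1"
  shows "(\<lambda>N. (real N + 1) ^ r * c ^ (N - r)) \<longlonglongrightarrow> 0"
proof (rule LIMSEQ_offset[of _ r], cases "r = 0")
  case True
  then show "(\<lambda>N. (real (N + r) + 1) ^ r * c ^ (N + r - r)) \<longlonglongrightarrow> 0"
    using LIMSEQ_power_zero[of c] assms by simp
next
  case False
  define d where "d = root r c"
  have d: "0 \<le> d" "d < 1" "d ^ r = c" using False assms by (auto simp: d_def)
  have "(\<lambda>N. real N * d ^ N + (real r + 1) * d ^ N) \<longlonglongrightarrow> 0 + (real r + 1) * 0"
    using d by (intro tendsto_intros powser_times_n_limit_0 LIMSEQ_power_zero) auto
  from tendsto_power[OF this, of r]
  have "(\<lambda>N. (real N * d ^ N + (real r + 1) * d ^ N) ^ r) \<longlonglongrightarrow> 0"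
    using False by (simp add: power_0_left)
  moreover have "real N * d ^ N + (real r + 1) * d ^ N = (real (N + r) + 1) * d ^ N" for N
    by (simp add: algebra_simps)
  moreover have "((real (N + r) + 1) * d ^ N) ^ r = (real (N + r) + 1) ^ r * c ^ (N + r - r)" for N
    unfolding d(3)[symmetric] by (simp add: power_mult_distrib mult.commute flip: power_mult)
  ultimately show "(\<lambda>N. (real (N + r) + 1) ^ r * c ^ (N + r - r)) \<longlonglongrightarrow> 0" by simp
qed

lemma sum_UNION_le:
  fixes f :: "'b \<Rightarrow> real"
  assumes "finite I" "\<And>i. i \<in> I \<Longrightarrow> finite (A i)" "\<And>i x. i \<in> I \<Longrightarrow> x \<in> A i \<Longrightarrow> f x \<ge> 0"
  shows "sum f (\<Union>i \<in> I. A i) \<le> (\<Sum>i \<in> I. sum f (A i))"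
  using assms
proof (induction I rule: finite_induct)
  case (insert i I)
  have "sum f (A i \<inter> (\<Union>i \<in> I. A i)) \<ge> 0" using insert.prems by (intro sum_nonneg) auto
  moreover have "sum f (A i \<union> (\<Union>i \<in> I. A i)) = sum f (A i) + sum f (\<Union>i \<in> I. A i) - sum f (A i \<inter> (\<Union>i \<in> I. A i))"
    using insert by (intro sum_Un) auto
  moreover have "sum f (\<Union>i \<in> I. A i) \<le> (\<Sum>i \<in> I. sum f (A i))"
    using insert.prems by (intro insert.IH) auto
  ultimately show ?case using insert.hyps by simp
qed simp

section \<open>Locality\<close>

text \<open>Assignments may take values outside the universe, so removing a quantifier records that
  the bound variable has its value inside. The set \<open>Y\<close> collects these variables, and
  the induction has to be general in it.\<close>

lemma sat_forall_list:
  "(\<forall>e. e ` Y \<subseteq> universe M \<longrightarrow> sat M e (forall_list xs p)) \<longleftrightarrow>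
   (\<forall>e. e ` (Y \<union> set xs) \<subseteq> universe M \<longrightarrow> sat M e p)"
proof (induction xs arbitrary: Y)
  case Nil
  then show ?case by (simp add: forall_list_def)
next
  case (Cons x xs)
  have "(\<forall>e. e ` Y \<subseteq> universe M \<longrightarrow> sat M e (forall_list (x # xs) p)) \<longleftrightarrow>
        (\<forall>e. e ` insert x Y \<subseteq> universe M \<longrightarrow> sat M e (forall_list xs p))" (is "?L \<longleftrightarrow> ?R")
  proof
    assume L: ?L
    show ?R
    proof (intro allI impI)
      fix e assume e: "e ` insert x Y \<subseteq> universe M"
      then have "sat M (e(x := e x)) (forall_list xs p)"
        using L[rule_format, of e] by (auto simp: forall_list_def)
      then show "sat M e (forall_list xs p)" by simp
    qed
  next
    assume R: ?R
    show ?L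
    proof (intro allI impI)
      fix e assume e: "e ` Y \<subseteq> universe M"
      have "sat M (e(x := a)) (forall_list xs p)" if "a \<in> universe M" for a
        using R[rule_format, of "e(x := a)"] e that by auto
      then show "sat M e (forall_list (x # xs) p)" by (simp add: forall_list_def)
    qed
  qed
  with Cons.IH[of "insert x Y"] show ?case by simp
qed

lemma models_forall_list:
  "M \<TTurnstile> forall_list xs p \<longleftrightarrow> (\<forall>e. e ` set xs \<subseteq> universe M \<longrightarrow> sat M e p)"
  using sat_forall_list[of "{}" M xs p] by (simp add: models_def)

lemma free_vars_forall_list: "free_vars (forall_list xs p) = free_vars p - set xs"
  by (induction xs) (auto simp: forall_list_def)

lemma sat_quantifier_free_transfer:
  assumes "quantifier_free q" "e ` free_vars q \<subseteq> Y" "inj_on f Y"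
    and "\<And>R zs. set zs \<subseteq> Y \<Longrightarrow> zs \<in> interp M R \<longleftrightarrow> map f zs \<in> interp A R"
  shows "sat M e q \<longleftrightarrow> sat A (f \<circ> e) q"
  using assms(1,2)
proof (induction q)
  case (Eq i j)
  then show ?case using assms(3) by (auto simp: inj_on_def)
next
  case (Rel R xs)
  then show ?case using assms(4)[of "map e xs" R] by (auto simp: comp_def)
qed auto

section \<open>Consequences of locality and irreflexivity for the models\<close>

text \<open>The guard of a local sentence has positive arity, so no assignment sends its variables
  into an empty universe, and the sentence holds vacuously.\<close>

lemma empty_in_Mod:
  assumes "\<forall>p \<in> \<Phi>. local_sentence \<Sigma> p" "is_structure \<Sigma> M" "universe M = {}"
  shows "M \<in> Mod \<Sigma> \<Phi>"
proof -
  have "M \<TTurnstile> p" if "p \<in> \<Phi>" for p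
  proof -
    from assms(1) that obtain R xs q where
      "length xs = arity \<Sigma> R" "arity \<Sigma> R > 0" "p = forall_list xs (Imp (Rel R xs) q)"
      unfolding local_sentence_def by blast
    then show ?thesis using assms(3) by (auto simp: models_forall_list)
  qed
  then show ?thesis using assms(2,3) by (auto simp: Mod_def)
qed

text \<open>A local sentence speaks only of the entries of one tuple satisfying its guard.
  Membership can therefore be tested separately on the entry set of each related tuple, where an
  injective copy inside some member is enough.\<close>

lemma Mod_local:
  assumes loc: "\<forall>p \<in> \<Phi>. local_sentence \<Sigma> p" and M: "is_structure \<Sigma> M" "finite (universe M)"
    and emb: "\<And>R xs. xs \<in> interp M R \<Longrightarrow> \<exists>A \<in> Mod \<Sigma> \<Phi>. \<exists>f. inj_on f (set xs) \<and>
           (\<forall>R' zs. set zs \<subseteq> set xs \<longrightarrow> (zs \<in> interp M R' \<longleftrightarrow> map f zs \<in> interp A R'))"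
  shows "M \<in> Mod \<Sigma> \<Phi>"
proof -
  have "M \<TTurnstile> p" if p: "p \<in> \<Phi>" for p
  proof -
    from loc p obtain R xs q where R: "R \<in> symbols \<Sigma>" "arity \<Sigma> R > 0" "length xs = arity \<Sigma> R"
      "quantifier_free q" and p_eq: "p = forall_list xs (Imp (Rel R xs) q)" and sen: "sentence \<Sigma> p"
      unfolding local_sentence_def by blast
    have fv: "free_vars q \<subseteq> set xs"
      using sen by (auto simp: sentence_def p_eq free_vars_forall_list)
    have "sat M e q" if e: "e ` set xs \<subseteq> universe M" "map e xs \<in> interp M R" for e
    proof -
      from emb[OF e(2)] obtain A f where A: "A \<in> Mod \<Sigma> \<Phi>" "inj_on f (e ` set xs)"
        "\<And>R' zs. set zs \<subseteq> e ` set xs \<Longrightarrow> zs \<in> interp M R' \<longleftrightarrow> map f zs \<in> interp A R'" by auto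
      have in_A: "map (f \<circ> e) xs \<in> interp A R" using A(3)[of "map e xs" R] e(2) by simp
      \<comment> \<open>The points \<open>f (e i)\<close> lie in the universe of \<open>A\<close>
        because they form a tuple in one of its relations; this makes \<open>f \<circ> e\<close> an
        admissible instance of the universal sentence.\<close>
      then have "(f \<circ> e) ` set xs \<subseteq> universe A"
        using A(1) R(1) unfolding Mod_def is_structure_def by fastforce
      moreover have "A \<TTurnstile> p" using A(1) p by (auto simp: Mod_def)
      ultimately have "sat A (f \<circ> e) (Imp (Rel R xs) q)"
        unfolding p_eq models_forall_list by blast
      then have "sat A (f \<circ> e) q" using in_A by simp
      then show ?thesis
        using sat_quantifier_free_transfer[OF R(4) _ A(2), of e M A] A(3) fv by (simp add: image_mono)
    qed
    then show ?thesis unfolding p_eq models_forall_list by simp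
  qed
  then show ?thesis using M by (auto simp: Mod_def)
qed

text \<open>If positions \<open>i\<close> and \<open>j\<close> carry the same entry, the assignment
  \<open>(!) xs\<close> violates the irreflexivity axiom for these two positions.\<close>

lemma Mod_distinct:
  assumes "general_irreflexivity \<Sigma> \<subseteq> \<Phi>" "S \<in> Mod \<Sigma> \<Phi>" "xs \<in> interp S R"
  shows "distinct xs"
proof (rule ccontr)
  assume "\<not> distinct xs"
  then obtain i j where ij: "i < length xs" "j < length xs" "i \<noteq> j" "xs ! i = xs ! j"
    by (auto simp: distinct_conv_nth)
  have R: "R \<in> symbols \<Sigma>" using assms(2,3) by (auto simp: Mod_def is_structure_def)
  have len: "length xs = arity \<Sigma> R" and univ: "set xs \<subseteq> universe S"
    using assms(2,3) R by (auto simp: Mod_def is_structure_def)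
  have "forall_list [0..<arity \<Sigma> R] (Imp (Rel R [0..<arity \<Sigma> R]) (Neg (Eq i j))) \<in> \<Phi>"
    using assms(1) R ij len unfolding general_irreflexivity_def by fastforce
  then have "S \<TTurnstile> forall_list [0..<arity \<Sigma> R] (Imp (Rel R [0..<arity \<Sigma> R]) (Neg (Eq i j)))"
    using assms(2) by (auto simp: Mod_def)
  moreover have "(!) xs ` set [0..<arity \<Sigma> R] \<subseteq> universe S"
    using univ len by (auto simp: subset_iff)
  moreover have "map ((!) xs) [0..<arity \<Sigma> R] = xs" unfolding len[symmetric] by (rule map_nth)
  ultimately show False using ij(4) assms(3) by (auto simp: models_forall_list)
qed

section \<open>Independent layers\<close>

text \<open>\<open>D\<close> is a family of entry sets, and a tuple is compared only if its entries
  form exactly a member of \<open>D\<close>; universes are ignored. For \<open>Pow X\<close> this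
  compares the induced relations on \<open>X\<close>; a bound on the cardinality of the sets yields
  frames.\<close>

definition agree :: "'a set set \<Rightarrow> ('r, 'a) struct \<Rightarrow> ('r, 'a) struct \<Rightarrow> bool" where
  "agree D S T \<longleftrightarrow> (\<forall>R xs. set xs \<in> D \<longrightarrow> (xs \<in> interp S R \<longleftrightarrow> xs \<in> interp T R))"

lemma agree_refl [simp]: "agree D S S"
  by (simp add: agree_def)

lemma agree_sym: "agree D S T \<Longrightarrow> agree D T S"
  by (simp add: agree_def)

lemma agree_trans: "agree D S T \<Longrightarrow> agree D T U \<Longrightarrow> agree D S U"
  by (simp add: agree_def)

lemma agree_mono: "agree D S T \<Longrightarrow> D' \<subseteq> D \<Longrightarrow> agree D' S T"
  by (auto simp: agree_def)

lemma agree_Un: "agree (D \<union> D') S T \<longleftrightarrow> agree D S T \<and> agree D' S T"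
  by (auto simp: agree_def)

definition down_closed :: "'a set set \<Rightarrow> bool" where
  "down_closed D \<longleftrightarrow> (\<forall>X \<in> D. \<forall>Y. Y \<subseteq> X \<longrightarrow> Y \<in> D)"

text \<open>A local class freed from its axioms: irreflexivity becomes distinctness of tuples, and
  locality becomes closure under checking the entry set of each related tuple. Positive arities make
  the empty structure unique.\<close>

locale framed_class =
  fixes \<Sigma> :: "'r signature" and K :: "('r, nat) struct set"
  assumes finite_symbols: "finite {R \<in> symbols \<Sigma>. arity \<Sigma> R = n}"
    and arity_pos: "R \<in> symbols \<Sigma> \<Longrightarrow> arity \<Sigma> R > 0"
    and K_structure: "S \<in> K \<Longrightarrow> is_structure \<Sigma> S"
    and K_finite: "S \<in> K \<Longrightarrow> finite (universe S)"
    and K_distinct: "S \<in> K \<Longrightarrow> xs \<in> interp S R \<Longrightarrow> distinct xs"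
    and K_local: "is_structure \<Sigma> M \<Longrightarrow> finite (universe M) \<Longrightarrow>
        (\<And>R xs. xs \<in> interp M R \<Longrightarrow> \<exists>A \<in> K. \<exists>f. inj_on f (set xs) \<and>
           (\<forall>R' zs. set zs \<subseteq> set xs \<longrightarrow> (zs \<in> interp M R' \<longleftrightarrow> map f zs \<in> interp A R'))) \<Longrightarrow>
        M \<in> K"
begin

lemma K_interp:
  assumes "S \<in> K" "xs \<in> interp S R"
  shows "R \<in> symbols \<Sigma>" "length xs = arity \<Sigma> R" "set xs \<subseteq> universe S" "card (set xs) = arity \<Sigma> R"
    "xs \<noteq> []"
proof -
  show R: "R \<in> symbols \<Sigma>" using K_structure[OF assms(1)] assms(2) by (auto simp: is_structure_def)
  then show len: "length xs = arity \<Sigma> R" and "set xs \<subseteq> universe S"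
    using K_structure[OF assms(1)] assms(2) by (auto simp: is_structure_def)
  show "card (set xs) = arity \<Sigma> R"
    using distinct_card[OF K_distinct[OF assms]] len by simp
  show "xs \<noteq> []" using arity_pos[OF R] len by auto
qed

text \<open>The form of locality with the identity as the map. Well-formedness of a tuple is
  inherited from the member of \<open>K\<close> that agrees on its entries, since the tuple itself
  is among those compared.\<close>

lemma K_local_agree:
  assumes "finite (universe M)"
    and "\<And>R xs. xs \<in> interp M R \<Longrightarrow>
          set xs \<subseteq> universe M \<and> (\<exists>A \<in> K. agree (Pow (set xs)) M A)"
  shows "M \<in> K"
proof (rule K_local)
  have *: "R \<in> symbols \<Sigma> \<and> length xs = arity \<Sigma> R" if "xs \<in> interp M R" for R xs
    using assms(2)[OF that] that K_interp(1,2)[of _ xs R] by (auto simp: agree_def)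
  show "is_structure \<Sigma> M" using * assms(2) unfolding is_structure_def by blast
  show "finite (universe M)" by fact
  show "\<exists>A \<in> K. \<exists>f. inj_on f (set xs) \<and>
       (\<forall>R' zs. set zs \<subseteq> set xs \<longrightarrow> (zs \<in> interp M R' \<longleftrightarrow> map f zs \<in> interp A R'))"
    if xs: "xs \<in> interp M R" for R xs
  proof -
    obtain A where A: "A \<in> K" "agree (Pow (set xs)) M A" using assms(2)[OF xs] by auto
    show ?thesis
      by (rule bexI[of _ A], rule exI[of _ id]) (use A in \<open>auto simp: agree_def\<close>)
  qed
qed

text \<open>Closure under isomorphic copies and under induced substructures in one statement:
  \<open>f\<close> itself is the local witness for every tuple.\<close>

lemma K_pullback:
  assumes A: "A \<in> K" and fin: "finite X" and f: "inj_on f X"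
  shows "Struct X (\<lambda>R. {xs. set xs \<subseteq> X \<and> map f xs \<in> interp A R}) \<in> K" (is "?M \<in> K")
proof (rule K_local)
  show "is_structure \<Sigma> ?M"
    using K_interp(1,2)[OF A] unfolding is_structure_def by fastforce
  show "finite (universe ?M)" using fin by simp
  show "\<exists>A \<in> K. \<exists>f. inj_on f (set xs) \<and>
       (\<forall>R' zs. set zs \<subseteq> set xs \<longrightarrow> (zs \<in> interp ?M R' \<longleftrightarrow> map f zs \<in> interp A R'))"
    if xs: "xs \<in> interp ?M R" for R xs
    by (rule bexI[OF _ A], rule exI[of _ f]) (use xs f in \<open>auto intro: inj_on_subset\<close>)
qed

lemma empty_in_K: "finite X \<Longrightarrow> Struct X (\<lambda>_. {}) \<in> K"
  by (rule K_local_agree) auto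

section \<open>Options per set of points, weights and cylinders\<close>

text \<open>The layers below \<open>X\<close> are copied from \<open>A\<close>; only the tuples with
  entry set exactly \<open>X\<close> remain free.\<close>

definition opts :: "('r, nat) struct \<Rightarrow> nat set \<Rightarrow> ('r, nat) struct set" where
  "opts A X = {T \<in> K. universe T = X \<and> agree {Y. Y \<subset> X} T A}"

definition opt_prob :: "('r, nat) struct \<Rightarrow> nat set \<Rightarrow> real" where
  "opt_prob A X = 1 / real (card (opts A X))"

definition wt :: "('r, nat) struct \<Rightarrow> real" where
  "wt S = (\<Prod>X \<in> Pow (universe S). opt_prob S X)"

definition on_set :: "nat set \<Rightarrow> ('r, nat) struct set" where
  "on_set V = {S \<in> K. universe S = V}"

definition cyl :: "nat set \<Rightarrow> ('r, nat) struct \<Rightarrow> nat set set \<Rightarrow> ('r, nat) struct set" where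
  "cyl V A D = {S \<in> on_set V. agree D S A}"

text \<open>Tuples have distinct entries, so on at most \<open>r\<close> points only symbols of
  arity at most \<open>r\<close> can hold, and there are finitely many of these. A structure is then
  a set of pairs of such a symbol and a list of length at most \<open>r\<close>. The bound is
  uniform in \<open>X\<close>, which later makes the extension probability depend on
  \<open>r\<close> alone.\<close>

lemma on_set_bound:
  "\<exists>m \<ge> 1. \<forall>X. finite X \<and> card X \<le> r \<longrightarrow> finite (on_set X) \<and> card (on_set X) \<le> m"
proof -
  define Sy where "Sy = {R \<in> symbols \<Sigma>. arity \<Sigma> R \<le> r}"
  have "Sy = (\<Union>n\<le>r. {R \<in> symbols \<Sigma>. arity \<Sigma> R = n})" by (auto simp: Sy_def)
  then have finSy: "finite Sy" using finite_symbols by simp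
  define m where "m = (2::nat) ^ (card Sy * (\<Sum>i\<le>r. Suc r ^ i))"
  have "finite (on_set X) \<and> card (on_set X) \<le> m" if X: "finite X" "card X \<le> r" for X
  proof -
    define Li where "Li = {xs. set xs \<subseteq> X \<and> length xs \<le> r}"
    have finL: "finite Li" unfolding Li_def by (rule finite_lists_length_le[OF X(1)])
    have cardL: "card Li \<le> (\<Sum>i\<le>r. Suc r ^ i)"
      unfolding Li_def card_lists_length_le[OF X(1)] using X(2) by (intro sum_mono power_mono) auto
    let ?h = "\<lambda>Q. Struct X (\<lambda>R. {xs. (R, xs) \<in> Q})"
    have sub: "on_set X \<subseteq> ?h ` Pow (Sy \<times> Li)"
    proof
      fix T assume T: "T \<in> on_set X"
      define Q where "Q = {(R, xs). xs \<in> interp T R}"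
      have "R \<in> Sy \<and> xs \<in> Li" if "xs \<in> interp T R" for R xs
      proof -
        have TK: "T \<in> K" "universe T = X" using T by (auto simp: on_set_def)
        have "card (set xs) \<le> card X"
          using K_interp(3)[OF TK(1) that] TK(2) X(1) by (simp add: card_mono)
        then show ?thesis
          using K_interp[OF TK(1) that] TK(2) X(2) by (auto simp: Sy_def Li_def)
      qed
      then have "Q \<in> Pow (Sy \<times> Li)" by (auto simp: Q_def)
      moreover have "T = ?h Q" using T by (cases T) (auto simp: Q_def on_set_def)
      ultimately show "T \<in> ?h ` Pow (Sy \<times> Li)" by blast
    qed
    have finP: "finite (Pow (Sy \<times> Li))" using finSy finL by simp
    have "card (on_set X) \<le> card (Pow (Sy \<times> Li))"
      by (rule order_trans[OF card_mono[OF finite_imageI[OF finP] sub] card_image_le[OF finP]])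
    also have "\<dots> = 2 ^ (card Sy * card Li)"
      using finSy finL by (simp add: card_Pow card_cartesian_product)
    also have "\<dots> \<le> m" unfolding m_def using cardL by (intro power_increasing mult_le_mono) auto
    finally show ?thesis using finite_subset[OF sub finite_imageI[OF finP]] by simp
  qed
  moreover have "m \<ge> 1" by (simp add: m_def)
  ultimately show ?thesis by blast
qed

lemma finite_on_set: "finite X \<Longrightarrow> finite (on_set X)"
  using on_set_bound[of "card X"] by blast

lemma finite_cyl: "finite V \<Longrightarrow> finite (cyl V A D)"
  unfolding cyl_def using finite_on_set by simp

lemma opts_subset: "opts A X \<subseteq> on_set X"
  by (auto simp: opts_def on_set_def)

lemma opts_cong: "agree {Y. Y \<subset> X} A B \<Longrightarrow> opts A X = opts B X"
  unfolding opts_def by (metis (no_types, lifting) agree_sym agree_trans)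

lemma opt_prob_cong: "agree {Y. Y \<subset> X} A B \<Longrightarrow> opt_prob A X = opt_prob B X"
  unfolding opt_prob_def by (simp only: opts_cong)

lemma opt_prob_cong_down:
  "down_closed D \<Longrightarrow> agree D A B \<Longrightarrow> X \<in> D \<Longrightarrow> opt_prob A X = opt_prob B X"
  by (rule opt_prob_cong, erule agree_mono) (auto simp: down_closed_def)

section \<open>Restriction to layers and amalgamation\<close>

text \<open>Keeps the layers of \<open>A\<close> in \<open>D\<close> and erases the rest. Equal
  results mean agreement on \<open>D\<close>, so the result also serves as a canonical label of a
  cylinder.\<close>

definition paste :: "nat set \<Rightarrow> nat set set \<Rightarrow> ('r, nat) struct \<Rightarrow> ('r, nat) struct" where
  "paste V D A = Struct V (\<lambda>R. {xs \<in> interp A R. set xs \<in> D})"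

text \<open>As \<open>D\<close> is down closed, a surviving tuple sees on all subsets of its entries
  the same relations as in \<open>A\<close>, so locality applies.\<close>

lemma paste_in_on_set:
  assumes "A \<in> K" "finite V" "D \<subseteq> Pow V" "down_closed D"
  shows "paste V D A \<in> on_set V"
proof -
  have "paste V D A \<in> K"
  proof (rule K_local_agree)
    fix R xs assume xs: "xs \<in> interp (paste V D A) R"
    have "agree (Pow (set xs)) (paste V D A) A"
      using assms(4) xs by (auto simp: agree_def paste_def down_closed_def)
    then show "set xs \<subseteq> universe (paste V D A) \<and> (\<exists>A' \<in> K. agree (Pow (set xs)) (paste V D A) A')"
      using assms(1,3) xs by (auto simp: paste_def)
  qed (simp add: paste_def assms)
  then show ?thesis by (simp add: on_set_def paste_def)
qed

lemma agree_paste: "agree D (paste V D A) A"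
  by (auto simp: agree_def paste_def)

lemma paste_eq_iff:
  "paste V D S = paste V D T \<longleftrightarrow> agree D S T"
  by (auto simp: agree_def paste_def fun_eq_iff set_eq_iff)

text \<open>Free amalgamation: take the tuples of \<open>A\<close> with entry set in
  \<open>D\<close> and those of \<open>B\<close> inside \<open>Z\<close>. Both families of sets are
  down closed, so below any tuple the result agrees with \<open>A\<close> alone or with
  \<open>B\<close> alone, and locality puts it in \<open>K\<close>.\<close>

lemma glue_exists:
  assumes "A \<in> K" "B \<in> K" "finite V" "D \<subseteq> Pow V" "down_closed D" "Z \<subseteq> V"
    and AB: "agree (D \<inter> Pow Z) A B"
  obtains G where "G \<in> on_set V" "agree D G A" "agree (Pow Z) G B"
proof
  define G where
    "G = Struct V (\<lambda>R. {xs. (set xs \<in> D \<and> xs \<in> interp A R) \<or> (set xs \<subseteq> Z \<and> xs \<in> interp B R)})"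
  show 1: "agree D G A" using AB by (auto simp: agree_def G_def)
  show 2: "agree (Pow Z) G B" using AB by (auto simp: agree_def G_def)
  have "G \<in> K"
  proof (rule K_local_agree)
    fix R xs assume xs: "xs \<in> interp G R"
    then consider "set xs \<in> D" | "set xs \<subseteq> Z" by (auto simp: G_def)
    then have "\<exists>A' \<in> K. agree (Pow (set xs)) G A'"
    proof cases
      case 1
      then have "Pow (set xs) \<subseteq> D" using assms(5) by (auto simp: down_closed_def)
      then show ?thesis using agree_mono[OF \<open>agree D G A\<close>] assms(1) by blast
    next
      case 2
      then have "Pow (set xs) \<subseteq> Pow Z" by auto
      then show ?thesis using agree_mono[OF \<open>agree (Pow Z) G B\<close>] assms(2) by blast
    qed
    then show "set xs \<subseteq> universe G \<and> (\<exists>A' \<in> K. agree (Pow (set xs)) G A')"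
      using xs assms(4,6) by (auto simp: G_def)
  qed (simp add: G_def assms)
  then show "G \<in> on_set V" by (simp add: on_set_def G_def)
qed

lemma down_closed_Pow: "down_closed (Pow X)"
  by (auto simp: down_closed_def)

text \<open>The restriction of \<open>A\<close> to \<open>X\<close> is itself an option.\<close>

lemma opts_card_pos:
  assumes "A \<in> K" "finite X"
  shows "card (opts A X) > 0"
proof -
  have "agree {Y. Y \<subset> X} (paste X (Pow X) A) A"
    by (rule agree_mono[OF agree_paste]) auto
  then have "paste X (Pow X) A \<in> opts A X"
    using paste_in_on_set[OF assms _ down_closed_Pow, of X] by (auto simp: opts_def on_set_def)
  moreover have "finite (opts A X)"
    using finite_subset[OF opts_subset finite_on_set[OF assms(2)]] .
  ultimately show ?thesis by (auto simp: card_gt_0_iff)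
qed

lemma opt_prob_pos: "A \<in> K \<Longrightarrow> finite X \<Longrightarrow> opt_prob A X > 0"
  using opts_card_pos[of A X] by (simp add: opt_prob_def)

lemma wt_pos: "S \<in> K \<Longrightarrow> wt S > 0"
  unfolding wt_def using K_finite[of S] by (intro prod_pos) (auto intro: opt_prob_pos finite_subset)

lemma on_set_eqI:
  assumes "S \<in> on_set V" "T \<in> on_set V" "agree (Pow V) S T"
  shows "S = T"
proof -
  have SK: "S \<in> K" "universe S = V" and TK: "T \<in> K" "universe T = V"
    using assms by (auto simp: on_set_def)
  have "xs \<in> interp S R \<longleftrightarrow> xs \<in> interp T R" for xs R
  proof (cases "set xs \<subseteq> V")
    case True
    then show ?thesis using assms(3) by (auto simp: agree_def)
  next
    case False
    then show ?thesis using K_interp(3)[OF SK(1)] K_interp(3)[OF TK(1)] SK TK by blast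
  qed
  then show ?thesis using SK TK by (cases S; cases T) (auto simp: fun_eq_iff)
qed

section \<open>The weight of a cylinder\<close>

lemma cyl_Pow:
  assumes "A \<in> K" "finite V"
  shows "cyl V A (Pow V) = {paste V (Pow V) A}"
proof -
  have p: "paste V (Pow V) A \<in> on_set V"
    by (rule paste_in_on_set[OF assms _ down_closed_Pow]) simp
  have "S = paste V (Pow V) A" if "S \<in> cyl V A (Pow V)" for S
    using that p agree_trans[OF _ agree_sym[OF agree_paste]] by (auto simp: cyl_def intro: on_set_eqI)
  then show ?thesis using p agree_paste by (auto simp: cyl_def)
qed

text \<open>\<open>X\<close> is a minimal set missing from \<open>D\<close>. Each option for
  \<open>X\<close> is compatible with \<open>A\<close> on \<open>D\<close>, so gluing realises it as
  some \<open>G T\<close>, and the cylinder falls apart according to the option that a structure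
  shows on \<open>X\<close>.\<close>

lemma cyl_split:
  assumes "A \<in> K" "finite V" "D \<subseteq> Pow V" "down_closed D" "X \<subseteq> V" "X \<notin> D"
    and min: "\<And>Y. Y \<subset> X \<Longrightarrow> Y \<in> D"
  obtains G where "\<And>T. T \<in> opts A X \<Longrightarrow> G T \<in> on_set V \<and> agree D (G T) A \<and> agree (Pow X) (G T) T"
    "cyl V A D = (\<Union>T \<in> opts A X. cyl V (G T) (insert X D))"
    "\<And>T T'. T \<in> opts A X \<Longrightarrow> T' \<in> opts A X \<Longrightarrow> T \<noteq> T' \<Longrightarrow>
       cyl V (G T) (insert X D) \<inter> cyl V (G T') (insert X D) = {}"
proof -
  \<comment> \<open>The overlap consists of the proper subsets of \<open>X\<close>, where an option
    agrees with \<open>A\<close> by definition; this is the compatibility needed for gluing.\<close>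
  have eq: "D \<inter> Pow X = {Y. Y \<subset> X}" using assms(6) min by auto
  have finX: "finite X" using assms(2,5) finite_subset by blast
  have "\<exists>G. G \<in> on_set V \<and> agree D G A \<and> agree (Pow X) G T" if "T \<in> opts A X" for T
    using that glue_exists[OF assms(1) _ assms(2-5), of T] unfolding eq
    by (metis (no_types, lifting) agree_sym mem_Collect_eq opts_def)
  then obtain G where G: "\<And>T. T \<in> opts A X \<Longrightarrow>
      G T \<in> on_set V \<and> agree D (G T) A \<and> agree (Pow X) (G T) T" by metis
  have sub: "Pow X \<subseteq> insert X D" using min by auto
  have cover: "cyl V A D = (\<Union>T \<in> opts A X. cyl V (G T) (insert X D))"
  proof (intro equalityI subsetI)
    fix S assume S: "S \<in> cyl V A D"
    define T where "T = paste X (Pow X) S"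
    have SK: "S \<in> K" and SA: "agree D S A" using S by (auto simp: cyl_def on_set_def)
    have TS: "agree (Pow X) T S" unfolding T_def by (rule agree_paste)
    have "agree {Y. Y \<subset> X} T A"
      using agree_mono[OF TS, of "{Y. Y \<subset> X}"] agree_mono[OF SA, of "{Y. Y \<subset> X}"] min
      by (blast intro: agree_trans)
    then have T: "T \<in> opts A X"
      using paste_in_on_set[OF SK finX order_refl down_closed_Pow]
      by (simp add: opts_def on_set_def T_def)
    have "agree (D \<union> Pow X) S (G T)"
      using G[OF T] SA TS unfolding agree_Un by (meson agree_sym agree_trans)
    then have "agree (insert X D) S (G T)" by (rule agree_mono) auto
    then show "S \<in> (\<Union>T \<in> opts A X. cyl V (G T) (insert X D))"
      using T S by (auto simp: cyl_def)
  next
    fix S assume "S \<in> (\<Union>T \<in> opts A X. cyl V (G T) (insert X D))"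
    then obtain T where T: "T \<in> opts A X" "S \<in> on_set V" "agree (insert X D) S (G T)"
      by (auto simp: cyl_def)
    have "agree D S A" using agree_mono[OF T(3)] G[OF T(1)] by (blast intro: agree_trans)
    then show "S \<in> cyl V A D" using T(2) by (simp add: cyl_def)
  qed
  have disj: "cyl V (G T) (insert X D) \<inter> cyl V (G T') (insert X D) = {}"
    if T: "T \<in> opts A X" "T' \<in> opts A X" "T \<noteq> T'" for T T'
  proof (rule ccontr)
    assume "cyl V (G T) (insert X D) \<inter> cyl V (G T') (insert X D) \<noteq> {}"
    then obtain S where "agree (insert X D) S (G T)" "agree (insert X D) S (G T')"
      by (auto simp: cyl_def)
    then have "agree (Pow X) S (G T)" "agree (Pow X) S (G T')" using sub agree_mono by blast+
    then have "agree (Pow X) T T'" using G[OF T(1)] G[OF T(2)] by (meson agree_sym agree_trans)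
    then show False using T opts_subset on_set_eqI by blast
  qed
  show ?thesis using that[OF G cover disj] by blast
qed

text \<open>Once the layers in \<open>D\<close> are fixed, the uniform choices on the other sets
  have total mass 1. The induction runs on the number of sets outside \<open>D\<close> and splits
  the cylinder at one further set.\<close>

lemma sum_wt_cyl:
  assumes "finite V" "D \<subseteq> Pow V" "down_closed D" "A \<in> K"
  shows "(\<Sum>S \<in> cyl V A D. wt S) = (\<Prod>X \<in> D. opt_prob A X)"
  using assms(2-4)
proof (induction "card (Pow V - D)" arbitrary: D A)
  case 0
  then have D: "D = Pow V" using assms(1) by auto
  have p: "paste V (Pow V) A \<in> on_set V"
    using paste_in_on_set[OF 0(4) assms(1) order_refl down_closed_Pow] .
  then have "wt (paste V (Pow V) A) = (\<Prod>X \<in> Pow V. opt_prob (paste V (Pow V) A) X)"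
    by (simp add: wt_def on_set_def)
  also have "\<dots> = (\<Prod>X \<in> Pow V. opt_prob A X)"
    by (intro prod.cong refl opt_prob_cong_down[OF down_closed_Pow agree_paste])
  finally show ?case using cyl_Pow[OF 0(4) assms(1)] by (simp add: D)
next
  case (Suc n)
  have finD: "finite D" using Suc.prems(1) assms(1) by (simp add: finite_subset)
  have "\<exists>X. X \<in> Pow V - D" using Suc.hyps(2) by (metis card.empty ex_in_conv nat.distinct(1))
  \<comment> \<open>A missing set of least cardinality has all its proper subsets in
    \<open>D\<close>.\<close>
  then obtain X where X: "X \<in> Pow V - D" and least: "\<And>Y. Y \<in> Pow V - D \<Longrightarrow> card X \<le> card Y"
    using ex_has_least_nat[of "\<lambda>X. X \<in> Pow V - D" _ card] by blast
  have finX: "finite X" using X assms(1) finite_subset by blast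
  have min: "Y \<in> D" if "Y \<subset> X" for Y
    using least[of Y] that X psubset_card_mono[OF finX that] by fastforce
  obtain G where G: "\<And>T. T \<in> opts A X \<Longrightarrow>
      G T \<in> on_set V \<and> agree D (G T) A \<and> agree (Pow X) (G T) T"
    and cov: "cyl V A D = (\<Union>T \<in> opts A X. cyl V (G T) (insert X D))"
    and dis: "\<And>T T'. T \<in> opts A X \<Longrightarrow> T' \<in> opts A X \<Longrightarrow> T \<noteq> T' \<Longrightarrow>
       cyl V (G T) (insert X D) \<inter> cyl V (G T') (insert X D) = {}"
    using cyl_split[OF Suc.prems(3) assms(1) Suc.prems(1,2) _ _ min, of X] X by blast
  have down': "down_closed (insert X D)"
    using Suc.prems(2) min unfolding down_closed_def by auto
  have "Pow V - insert X D = (Pow V - D) - {X}" by auto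
  then have n: "n = card (Pow V - insert X D)" using Suc.hyps(2) X assms(1) by simp
  have "(\<Sum>S \<in> cyl V (G T) (insert X D). wt S) = opt_prob A X * (\<Prod>Y \<in> D. opt_prob A Y)"
    if T: "T \<in> opts A X" for T
  proof -
    have ag: "agree D (G T) A" and GK: "G T \<in> K" using G[OF T] by (auto simp: on_set_def)
    have "(\<Sum>S \<in> cyl V (G T) (insert X D). wt S) = (\<Prod>Y \<in> insert X D. opt_prob (G T) Y)"
      using Suc.hyps(1)[OF n _ down' GK] X Suc.prems(1) by simp
    also have "\<dots> = (\<Prod>Y \<in> insert X D. opt_prob A Y)"
    \<comment> \<open>The options on \<open>Y\<close> depend only on the proper subsets of
      \<open>Y\<close>. These lie in \<open>D\<close>, also for \<open>Y = X\<close>, and there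
      \<open>G T\<close> agrees with \<open>A\<close>.\<close>
    proof (intro prod.cong refl opt_prob_cong agree_mono[OF ag])
      fix Y assume "Y \<in> insert X D"
      then show "{Y'. Y' \<subset> Y} \<subseteq> D" using min Suc.prems(2) by (auto simp: down_closed_def)
    qed
    finally show ?thesis using X finD by simp
  qed
  then have "(\<Sum>S \<in> cyl V A D. wt S) =
      (\<Sum>T \<in> opts A X. opt_prob A X * (\<Prod>Y \<in> D. opt_prob A Y))"
    unfolding cov using dis finite_cyl[OF assms(1)]
    by (subst sum.UNION_disjoint)
       (auto intro: finite_subset[OF opts_subset finite_on_set[OF finX]])
  \<comment> \<open>There are \<open>card (opts A X)\<close> pieces of equal weight, which cancels
    the factor \<open>opt_prob A X\<close>.\<close>
  also have "\<dots> = (\<Prod>Y \<in> D. opt_prob A Y)"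
    using opts_card_pos[OF Suc.prems(3) finX] by (simp add: opt_prob_def)
  finally show ?case .
qed

lemma sum_wt_on_set:
  assumes "finite V"
  shows "(\<Sum>S \<in> on_set V. wt S) = 1"
proof -
  have "cyl V (Struct V (\<lambda>_. {})) {} = on_set V" by (auto simp: cyl_def agree_def)
  then show ?thesis
    using sum_wt_cyl[OF assms, of "{}" "Struct V (\<lambda>_. {})"] empty_in_K[OF assms]
    by (simp add: down_closed_def)
qed

text \<open>Positive arities leave nothing to choose on the empty set; this matches the initial
  value 1 of \<open>frame_weight\<close>.\<close>

lemma opt_prob_empty: "A \<in> K \<Longrightarrow> opt_prob A {} = 1"
proof -
  assume A: "A \<in> K"
  have uniq: "T = Struct {} (\<lambda>_. {})" if T: "T \<in> K" "universe T = {}" for T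
  proof -
    have "interp T R = {}" for R using K_interp(3,5)[OF T(1)] T(2) by fastforce
    then show ?thesis using T(2) by (cases T) (auto simp: fun_eq_iff)
  qed
  have "opts A {} = {Struct {} (\<lambda>_. {})}"
  proof (intro equalityI subsetI)
    show "T \<in> {Struct {} (\<lambda>_. {})}" if "T \<in> opts A {}" for T
      using uniq[of T] that by (simp add: opts_def)
  qed (use empty_in_K[of "{}"] in \<open>simp add: opts_def agree_def\<close>)
  then show ?thesis by (simp add: opt_prob_def)
qed

section \<open>The frame-wise uniform measure as a weight\<close>

text \<open>Tuples are distinct, so the arity of a relation is the cardinality of the entry set.
  Cutting off by arity, as frames do, is thus cutting off by the size of sets.\<close>

lemma agree_card_iff:
  assumes "S \<in> K" "T \<in> K"
  shows "agree {X \<in> Pow U. card X \<le> k} S T \<longleftrightarrow>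
    (\<forall>R. arity \<Sigma> R \<le> k \<longrightarrow> {xs \<in> interp S R. set xs \<subseteq> U} = {xs \<in> interp T R. set xs \<subseteq> U})"
    (is "?L \<longleftrightarrow> ?R")
proof
  assume L: ?L
  have "xs \<in> interp S R \<longleftrightarrow> xs \<in> interp T R" if "arity \<Sigma> R \<le> k" "set xs \<subseteq> U" for R xs
    using L that K_interp(4)[OF assms(1), of xs R] K_interp(4)[OF assms(2), of xs R]
    unfolding agree_def by auto
  then show ?R by auto
next
  assume R: ?R
  have "xs \<in> interp S R \<longleftrightarrow> xs \<in> interp T R" if "set xs \<subseteq> U" "card (set xs) \<le> k" for R xs
    using R[rule_format, of R] that K_interp(4)[OF assms(1), of xs R] K_interp(4)[OF assms(2), of xs R]
    by (auto simp: set_eq_iff)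
  then show ?L by (auto simp: agree_def)
qed

lemma frame_eq_iff:
  assumes "S \<in> on_set V" "T \<in> on_set V"
  shows "frame \<Sigma> k S = frame \<Sigma> k T \<longleftrightarrow> agree {X \<in> Pow V. card X \<le> k} S T"
proof -
  have ST: "S \<in> K" "T \<in> K" "universe S = V" "universe T = V" using assms by (auto simp: on_set_def)
  have "{xs \<in> interp S R. set xs \<subseteq> V} = interp S R" "{xs \<in> interp T R. set xs \<subseteq> V} = interp T R" for R
    using K_interp(3)[OF ST(1)] K_interp(3)[OF ST(2)] ST by blast+
  then show ?thesis
    unfolding agree_card_iff[OF ST(1,2)] using ST(3,4) by (auto simp: frame_def fun_eq_iff)
qed

lemma frame_cylinder_eq:
  assumes "A \<in> within_size K N"
  shows "frame_cylinder \<Sigma> K N A k = cyl {..<N} A {X \<in> Pow (universe A). card X \<le> k}"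
proof -
  have A: "A \<in> K" "universe A \<subseteq> {..<N}" using assms by (auto simp: within_size_def)
  have A': "{xs \<in> interp A R. set xs \<subseteq> universe A} = interp A R" for R
    using K_interp(3)[OF A(1)] by blast
  have "frame \<Sigma> k (induced S (universe A)) = frame \<Sigma> k A \<longleftrightarrow>
      agree {X \<in> Pow (universe A). card X \<le> k} S A" if "S \<in> on_size K N" for S
  proof -
    have S: "S \<in> K" "universe S = {..<N}" using that by (auto simp: on_size_def)
    have "universe S \<inter> universe A = universe A" using S A by auto
    then show ?thesis
      unfolding agree_card_iff[OF S(1) A(1)] A' by (auto simp: frame_def induced_def fun_eq_iff)
  qed
  then show ?thesis by (auto simp: frame_cylinder_def cyl_def on_size_def on_set_def)
qed

lemma down_closed_card: "finite V \<Longrightarrow> down_closed {X \<in> Pow V. card X \<le> k}"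
  unfolding down_closed_def using card_mono finite_subset
  by (metis (no_types, lifting) Pow_iff mem_Collect_eq order_trans)

text \<open>The cylinder of the \<open>k\<close>-frame of \<open>A\<close> is partitioned by the
  \<open>Suc k\<close>-frames of its members. All blocks have the same weight, so the product for
  \<open>k\<close> is \<open>num_frames\<close> times the product for \<open>Suc k\<close>, which is
  the recursion of \<open>frame_weight\<close>.\<close>

lemma frame_weight_eq:
  assumes A: "A \<in> K"
  shows "frame_weight \<Sigma> K A k = (\<Prod>X \<in> {X \<in> Pow (universe A). card X \<le> k}. opt_prob A X)"
proof (induction k)
  case 0
  have "X = {}" if "X \<subseteq> universe A" "card X = 0" for X
    using that K_finite[OF A] finite_subset by fastforce
  then have "{X \<in> Pow (universe A). card X \<le> 0} = {{}}" by auto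
  then show ?case by (simp add: opt_prob_empty[OF A])
next
  case (Suc k)
  define V where "V = universe A"
  define D where "D k = {X \<in> Pow V. card X \<le> k}" for k
  have fin: "finite V" using K_finite[OF A] by (simp add: V_def)
  have down: "down_closed (D k)" for k unfolding D_def by (rule down_closed_card[OF fin])
  have DV: "D k \<subseteq> Pow V" for k by (auto simp: D_def)
  define C where "C = cyl V A (D k)"
  define P where "P k = (\<Prod>X \<in> D k. opt_prob A X)" for k
  have A_V: "A \<in> on_set V" using A by (simp add: on_set_def V_def)
  have frames: "frame \<Sigma> (Suc k) ` C =
      {frame \<Sigma> (k + 1) T | T. T \<in> K \<and> universe T = universe A \<and> frame \<Sigma> k T = frame \<Sigma> k A}"
  proof -
    have "C = {T. T \<in> K \<and> universe T = universe A \<and> frame \<Sigma> k T = frame \<Sigma> k A}"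
      unfolding C_def cyl_def D_def using frame_eq_iff[OF _ A_V, of _ k]
      by (auto simp: on_set_def V_def)
    then show ?thesis by auto
  qed
  have inner: "(\<Sum>S \<in> {S \<in> C. frame \<Sigma> (Suc k) S = y}. wt S) = P (Suc k)"
    if y: "y \<in> frame \<Sigma> (Suc k) ` C" for y
  proof -
    obtain S0 where S0: "S0 \<in> C" "y = frame \<Sigma> (Suc k) S0" using y by auto
    have S0_V: "S0 \<in> on_set V" and S0_A: "agree (D k) S0 A" using S0(1) by (auto simp: C_def cyl_def)
    have sub: "D k \<subseteq> D (Suc k)" by (auto simp: D_def)
    have "{S \<in> C. frame \<Sigma> (Suc k) S = y} = cyl V S0 (D (Suc k))"
    proof (intro equalityI subsetI)
      fix S assume S: "S \<in> {S \<in> C. frame \<Sigma> (Suc k) S = y}"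
      then show "S \<in> cyl V S0 (D (Suc k))"
        using frame_eq_iff[OF _ S0_V, of S "Suc k"] S0(2) by (auto simp: C_def cyl_def D_def)
    next
      fix S assume S: "S \<in> cyl V S0 (D (Suc k))"
      then have "agree (D k) S A"
        using agree_trans[OF agree_mono[OF _ sub] S0_A] by (auto simp: cyl_def)
      then show "S \<in> {S \<in> C. frame \<Sigma> (Suc k) S = y}"
        using S frame_eq_iff[OF _ S0_V, of S "Suc k"] S0(2) by (auto simp: C_def cyl_def D_def)
    qed
    then have "(\<Sum>S \<in> {S \<in> C. frame \<Sigma> (Suc k) S = y}. wt S) = (\<Prod>X \<in> D (Suc k). opt_prob S0 X)"
      using sum_wt_cyl[OF fin DV down] S0_V by (simp add: on_set_def)
    also have "\<dots> = P (Suc k)" unfolding P_def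
    \<comment> \<open>A proper subset of a set with at most \<open>Suc k\<close> points has at most
      \<open>k\<close> points, so the options are already determined by the common
      \<open>k\<close>-frame.\<close>
    proof (intro prod.cong refl opt_prob_cong agree_mono[OF S0_A] subsetI)
      fix X Y assume X: "X \<in> D (Suc k)" and Y: "Y \<in> {Y. Y \<subset> X}"
      have "finite X" using X fin by (auto simp: D_def intro: finite_subset)
      then have "card Y < card X" using Y by (auto intro: psubset_card_mono)
      then show "Y \<in> D k" using X Y by (auto simp: D_def)
    qed
    finally show ?thesis .
  qed
  have finC: "finite C" unfolding C_def by (rule finite_cyl[OF fin])
  have "P k = (\<Sum>S \<in> C. wt S)"
    unfolding P_def C_def using sum_wt_cyl[OF fin DV down A] by simp
  also have "\<dots> = (\<Sum>y \<in> frame \<Sigma> (Suc k) ` C. \<Sum>S \<in> {S \<in> C. frame \<Sigma> (Suc k) S = y}. wt S)"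
    by (rule sum.image_gen[OF finC])
  also have "\<dots> = real (num_frames \<Sigma> K A k) * P (Suc k)"
    using inner frames by (simp add: num_frames_def)
  finally have eq: "P k = real (num_frames \<Sigma> K A k) * P (Suc k)" .
  have "frame \<Sigma> (Suc k) ` C \<noteq> {}" using A_V by (auto simp: C_def cyl_def)
  then have "num_frames \<Sigma> K A k \<noteq> 0"
    using finC unfolding num_frames_def frames[symmetric] by simp
  then have "P (Suc k) = P k / real (num_frames \<Sigma> K A k)" using eq by simp
  then show ?case using Suc by (simp add: P_def D_def V_def)
qed

lemma on_size_eq_on_set: "on_size K N = on_set {..<N}"
  by (simp add: on_size_def on_set_def)

text \<open>\<open>extend_measure\<close> attains its prescribed values once some measure does. The
  point measure with density \<open>wt\<close> gives every cylinder its \<open>frame_weight\<close>,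
  so it is such a measure. Singletons are cylinders too, hence the values on the finite space are
  determined.\<close>

lemma framewise_uniform_measure:
  assumes E: "E \<subseteq> on_set {..<N}"
  shows "measure (framewise_uniform \<Sigma> K N) E = (\<Sum>S \<in> E. wt S)"
proof -
  define \<Omega> where "\<Omega> = on_set {..<N}"
  define I where "I = within_size K N \<times> (UNIV :: nat set)"
  define G where "G = (\<lambda>(A, k). frame_cylinder \<Sigma> K N A k)"
  define w where "w = (\<lambda>(A, k). ennreal (frame_weight \<Sigma> K A k))"
  define M where "M = extend_measure \<Omega> I G w"
  define \<mu> where "\<mu> = emeasure (point_measure \<Omega> (\<lambda>S. ennreal (wt S)))"
  have fin\<Omega>: "finite \<Omega>" unfolding \<Omega>_def by (simp add: finite_on_set)
  have GI: "G ` I \<subseteq> Pow \<Omega>"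
    by (auto simp: G_def \<Omega>_def frame_cylinder_def on_size_eq_on_set)
  have \<mu>_eq: "\<mu> X = ennreal (\<Sum>S \<in> X. wt S)" if "X \<subseteq> \<Omega>" for X
  proof -
    have "\<mu> X = (\<Sum>S \<in> X. ennreal (wt S))"
      unfolding \<mu>_def using emeasure_point_measure_finite[OF fin\<Omega> that] .
    also have "\<dots> = ennreal (\<Sum>S \<in> X. wt S)"
      using that wt_pos by (intro sum_ennreal) (force simp: \<Omega>_def on_set_def)
    finally show ?thesis .
  qed
  have \<mu>_w: "\<mu> (G i) = w i" if iI: "i \<in> I" for i
  proof -
    obtain A k where i: "i = (A, k)" and A: "A \<in> within_size K N" using iI by (auto simp: I_def)
    have AK: "A \<in> K" and sub: "universe A \<subseteq> {..<N}" using A by (auto simp: within_size_def)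
    have "G i \<subseteq> \<Omega>" using GI iI by auto
    moreover have "G i = cyl {..<N} A {X \<in> Pow (universe A). card X \<le> k}"
      by (simp add: G_def i frame_cylinder_eq[OF A])
    moreover have "{X \<in> Pow (universe A). card X \<le> k} \<subseteq> Pow {..<N}" using sub by auto
    ultimately show ?thesis
      using sum_wt_cyl[OF _ _ down_closed_card[OF K_finite[OF AK]] AK] frame_weight_eq[OF AK]
      by (simp add: \<mu>_eq w_def i)
  qed
  have sets: "sets M = sigma_sets \<Omega> (G ` I)"
    unfolding M_def by (rule sets_extend_measure[OF GI])
  have sets_sub: "sets M \<subseteq> Pow \<Omega>" using sets sigma_sets_into_sp[OF GI] by auto
  have meas: "measure_space \<Omega> (Pow \<Omega>) \<mu>"
    using measure_space[of "point_measure \<Omega> (\<lambda>S. ennreal (wt S))"]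
    by (simp add: \<mu>_def space_point_measure sets_point_measure)
  have pos: "positive (sets M) \<mu>" by (simp add: positive_def \<mu>_def)
  have add: "countably_additive (sets M) \<mu>"
    using meas sets_sub unfolding measure_space_def countably_additive_def
    by (meson order_trans subsetD)
  have em: "emeasure M (G i) = w i" if "i \<in> I" for i
    by (rule emeasure_extend_measure[OF M_def \<mu>_w GI pos add that])
  have single: "{S} \<in> sets M \<and> emeasure M {S} = ennreal (wt S)" if S: "S \<in> \<Omega>" for S
  proof -
    have SK: "S \<in> K" "universe S = {..<N}" using S by (auto simp: \<Omega>_def on_set_def)
    \<comment> \<open>Level \<open>N\<close> suffices to isolate \<open>S\<close>, as every subset
      of \<open>{..<N}\<close> has at most \<open>N\<close> elements.\<close>
    have iI: "(S, N) \<in> I" using SK by (auto simp: I_def within_size_def)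
    have D: "{X \<in> Pow {..<N}. card X \<le> N} = Pow {..<N}"
      using card_mono[of "{..<N}"] by fastforce
    have "G (S, N) = cyl {..<N} S (Pow {..<N})"
      using frame_cylinder_eq[of S N N] iI SK(2) D by (simp add: G_def I_def)
    also have "\<dots> = {S}"
      using on_set_eqI[of _ "{..<N}" S] S by (auto simp: cyl_def \<Omega>_def)
    finally have G: "G (S, N) = {S}" .
    moreover have "w (S, N) = ennreal (wt S)"
      using \<mu>_w[OF iI] \<mu>_eq[of "{S}"] S by (simp add: G)
    moreover have "G (S, N) \<in> sets M" unfolding sets using iI by auto
    ultimately show ?thesis using em[OF iI] by simp
  qed
  have E\<Omega>: "E \<subseteq> \<Omega>" using E by (simp add: \<Omega>_def)
  have "emeasure M E = (\<Sum>S \<in> E. emeasure M {S})"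
    using E\<Omega> single finite_subset[OF E\<Omega> fin\<Omega>] by (intro emeasure_eq_sum_singleton) auto
  also have "\<dots> = (\<Sum>S \<in> E. ennreal (wt S))" using E\<Omega> single by (intro sum.cong) auto
  also have "\<dots> = \<mu> E"
    unfolding \<mu>_def using emeasure_point_measure_finite[OF fin\<Omega> E\<Omega>] by simp
  also have "\<dots> = ennreal (\<Sum>S \<in> E. wt S)" by (rule \<mu>_eq[OF E\<Omega>])
  finally have "measure M E = (\<Sum>S \<in> E. wt S)"
    using E\<Omega> wt_pos
    by (intro measure_eq_emeasure_eq_ennreal sum_nonneg) (force simp: \<Omega>_def on_set_def)+
  moreover have "framewise_uniform \<Sigma> K N = M"
    unfolding framewise_uniform_def M_def \<Omega>_def I_def G_def w_def on_size_eq_on_set ..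
  ultimately show ?thesis by simp
qed

section \<open>Extension axioms\<close>

text \<open>Conditional independence of the layers: \<open>E\<close> is an event decided by the
  layers in \<open>D\<close>, and on the part of \<open>Z\<close> already decided it is consistent
  with \<open>B\<close>. The remaining layers of \<open>B\<close> on \<open>Z\<close> then appear
  with the product of their option probabilities. The proof splits \<open>E\<close> into cylinders
  labelled by \<open>paste V D\<close>.\<close>

lemma sum_wt_extension:
  assumes fin: "finite V" and D: "D \<subseteq> Pow V" "down_closed D" and E: "E \<subseteq> on_set V"
    and det: "\<And>S S'. S \<in> E \<Longrightarrow> S' \<in> on_set V \<Longrightarrow> agree D S S' \<Longrightarrow> S' \<in> E"
    and Z: "Z \<subseteq> V" and B: "B \<in> K" and EB: "\<And>S. S \<in> E \<Longrightarrow> agree (D \<inter> Pow Z) S B"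
  shows "(\<Sum>S \<in> {S \<in> E. agree (Pow Z) S B}. wt S) =
         (\<Sum>S \<in> E. wt S) * (\<Prod>X \<in> Pow Z - D. opt_prob B X)"
proof -
  let ?h = "paste V D" and ?E' = "{S \<in> E. agree (Pow Z) S B}"
  let ?c = "\<Prod>X \<in> Pow Z - D. opt_prob B X"
  have finE: "finite E" using finite_subset[OF E finite_on_set[OF fin]] .
  have finD: "finite D" using D(1) fin by (simp add: finite_subset)
  have inner: "(\<Sum>S \<in> {S \<in> ?E'. ?h S = y}. wt S) = (\<Sum>S \<in> {S \<in> E. ?h S = y}. wt S) * ?c"
    if y: "y \<in> ?h ` E" for y
  proof -
    obtain S0 where S0: "S0 \<in> E" "y = ?h S0" using y by auto
    have S0K: "S0 \<in> K" using S0(1) E by (auto simp: on_set_def)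
    \<comment> \<open>Combining a representative of the block with \<open>B\<close> shows that the
      event inside the block is again a cylinder, namely the one around \<open>G\<close> on
      \<open>D \<union> Pow Z\<close>.\<close>
    obtain G where G: "G \<in> on_set V" "agree D G S0" "agree (Pow Z) G B"
      by (rule glue_exists[OF S0K B fin D Z EB[OF S0(1)]])
    have GK: "G \<in> K" using G(1) by (simp add: on_set_def)
    have 1: "{S \<in> E. ?h S = y} = cyl V S0 D"
      using E det[OF S0(1)] by (auto simp: S0(2) paste_eq_iff cyl_def dest: agree_sym)
    have 2: "{S \<in> ?E'. ?h S = y} = cyl V G (D \<union> Pow Z)"
    proof -
      have "{S \<in> ?E'. ?h S = y} = {S \<in> cyl V S0 D. agree (Pow Z) S B}" using 1 by auto
      also have "\<dots> = cyl V G (D \<union> Pow Z)"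
        unfolding cyl_def agree_Un using G(2,3) by (blast intro: agree_trans agree_sym)
      finally show ?thesis .
    qed
    have down: "down_closed (D \<union> Pow Z)" using D(2) by (auto simp: down_closed_def)
    have "(\<Sum>S \<in> {S \<in> ?E'. ?h S = y}. wt S) = (\<Prod>X \<in> D \<union> Pow Z. opt_prob G X)"
      unfolding 2 using D(1) Z by (intro sum_wt_cyl[OF fin _ down GK]) auto
    also have "D \<union> Pow Z = D \<union> (Pow Z - D)" by auto
    also have "(\<Prod>X \<in> D \<union> (Pow Z - D). opt_prob G X) =
        (\<Prod>X \<in> D. opt_prob G X) * (\<Prod>X \<in> Pow Z - D. opt_prob G X)"
      using finD finite_subset[OF Z fin] by (intro prod.union_disjoint) auto
    also have "(\<Prod>X \<in> D. opt_prob G X) = (\<Prod>X \<in> D. opt_prob S0 X)"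
      by (intro prod.cong refl opt_prob_cong_down[OF D(2) G(2)])
    also have "(\<Prod>X \<in> Pow Z - D. opt_prob G X) = ?c"
      by (intro prod.cong refl opt_prob_cong_down[OF down_closed_Pow G(3)]) auto
    also have "(\<Prod>X \<in> D. opt_prob S0 X) = (\<Sum>S \<in> {S \<in> E. ?h S = y}. wt S)"
      unfolding 1 using sum_wt_cyl[OF fin D S0K] by simp
    finally show ?thesis .
  qed
  have "(\<Sum>S \<in> ?E'. wt S) = (\<Sum>y \<in> ?h ` E. \<Sum>S \<in> {S \<in> ?E'. ?h S = y}. wt S)"
    using finE by (intro sum.group[symmetric]) auto
  also have "\<dots> = (\<Sum>y \<in> ?h ` E. \<Sum>S \<in> {S \<in> E. ?h S = y}. wt S) * ?c"
    using inner by (simp add: sum_distrib_right)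
  also have "(\<Sum>y \<in> ?h ` E. \<Sum>S \<in> {S \<in> E. ?h S = y}. wt S) = (\<Sum>S \<in> E. wt S)"
    using sum.image_gen[OF finE, of wt ?h] by simp
  finally show ?thesis .
qed

text \<open>The points of \<open>W\<close> are examined one at a time. The sets
  \<open>insert a X\<close> for distinct \<open>a\<close> overlap only in \<open>X\<close>, so given
  the earlier failures the next point still succeeds with probability at least
  \<open>p\<close>.\<close>

lemma sum_wt_no_extension:
  assumes fin: "finite V" and X: "X \<subseteq> V" and W: "W \<subseteq> V - X" and B: "B \<in> K"
    and Ba: "\<And>a. a \<in> W \<Longrightarrow> Ba a \<in> K \<and> agree (Pow X) (Ba a) B"
    and p: "p \<le> 1"
      "\<And>a. a \<in> W \<Longrightarrow> p \<le> (\<Prod>Y \<in> {Y \<in> Pow (insert a X). a \<in> Y}. opt_prob (Ba a) Y)"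
  shows "(\<Sum>S \<in> {S \<in> on_set V. agree (Pow X) S B \<and>
            (\<forall>a \<in> W. \<not> agree (Pow (insert a X)) S (Ba a))}. wt S) \<le> (1 - p) ^ card W"
proof -
  have finW: "finite W" using finite_subset[OF W] fin by simp
  show ?thesis using finW W Ba p(2)
  proof (induction W rule: finite_induct)
    case empty
    have "(\<Sum>S \<in> {S \<in> on_set V. agree (Pow X) S B}. wt S) \<le> (\<Sum>S \<in> on_set V. wt S)"
      using wt_pos finite_on_set[OF fin] by (intro sum_mono2) (force simp: on_set_def)+
    then show ?case using sum_wt_on_set[OF fin] by simp
  next
    case (insert a W)
    define E where "E = {S \<in> on_set V. agree (Pow X) S B \<and>
        (\<forall>b \<in> W. \<not> agree (Pow (insert b X)) S (Ba b))}"
    define D where "D = Pow X \<union> (\<Union>b \<in> W. Pow (insert b X))"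
    define Z where "Z = insert a X"
    have aV: "a \<in> V" "a \<notin> X" using insert.prems(1) by auto
    have DV: "D \<subseteq> Pow V" using insert.prems(1) X by (auto simp: D_def)
    have down: "down_closed D" by (fastforce simp: D_def down_closed_def)
    \<comment> \<open>The layers exposed so far meet those of the new point only inside
      \<open>X\<close>; the sets still undecided are those containing \<open>a\<close>.\<close>
    have DZ: "D \<inter> Pow Z = Pow X" "Pow Z - D = {Y \<in> Pow (insert a X). a \<in> Y}"
      using insert.hyps(2) aV by (auto simp: D_def Z_def)
    have Ba_a: "Ba a \<in> K" "agree (Pow X) (Ba a) B" using insert.prems(2) by auto
    have det: "S' \<in> E" if S: "S \<in> E" and S': "S' \<in> on_set V" and ag: "agree D S S'" for S S'
    proof -
      have "agree (Pow X) S S'" using ag by (rule agree_mono) (auto simp: D_def)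
      moreover have "agree (Pow (insert b X)) S S'" if "b \<in> W" for b
        using ag by (rule agree_mono) (use that in \<open>auto simp: D_def\<close>)
      ultimately show ?thesis using S S' unfolding E_def
        by (blast intro: agree_trans agree_sym)
    qed
    have EB: "agree (D \<inter> Pow Z) S (Ba a)" if "S \<in> E" for S
      using that Ba_a(2) unfolding DZ E_def by (blast intro: agree_trans agree_sym)
    have ext: "(\<Sum>S \<in> {S \<in> E. agree (Pow Z) S (Ba a)}. wt S) =
        (\<Sum>S \<in> E. wt S) * (\<Prod>Y \<in> {Y \<in> Pow (insert a X). a \<in> Y}. opt_prob (Ba a) Y)"
      using sum_wt_extension[OF fin DV down _ det _ Ba_a(1) EB] aV X unfolding DZ(2)
      by (auto simp: E_def Z_def)
    have E_nonneg: "(\<Sum>S \<in> E. wt S) \<ge> 0"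
      using wt_pos by (intro sum_nonneg) (force simp: E_def on_set_def)
    have finE: "finite E" using finite_on_set[OF fin] by (simp add: E_def)
    have "{S \<in> on_set V. agree (Pow X) S B \<and>
          (\<forall>b \<in> insert a W. \<not> agree (Pow (insert b X)) S (Ba b))} =
        E - {S \<in> E. agree (Pow Z) S (Ba a)}" by (auto simp: E_def Z_def)
    then have "(\<Sum>S \<in> {S \<in> on_set V. agree (Pow X) S B \<and>
          (\<forall>b \<in> insert a W. \<not> agree (Pow (insert b X)) S (Ba b))}. wt S) =
        (\<Sum>S \<in> E. wt S) - (\<Sum>S \<in> {S \<in> E. agree (Pow Z) S (Ba a)}. wt S)"
      using sum_diff[OF finE, of "{S \<in> E. agree (Pow Z) S (Ba a)}" wt] by auto
    also have "\<dots> \<le> (\<Sum>S \<in> E. wt S) * (1 - p)"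
      unfolding ext using mult_left_mono[OF insert.prems(3)[of a] E_nonneg]
      by (simp add: algebra_simps)
    also have "\<dots> \<le> (1 - p) ^ card W * (1 - p)"
      using insert.IH insert.prems p(1) unfolding E_def by (intro mult_right_mono) auto
    finally show ?case using insert.hyps by (simp add: mult.commute)
  qed
qed

text \<open>There are at most \<open>2 ^ r\<close> factors, and each is at least
  \<open>1 / m\<close> because the options on a set are among the members of \<open>K\<close> on
  that set. This provides the \<open>p\<close> for one-point extensions.\<close>

lemma prod_opt_prob_lower:
  assumes m: "m \<ge> 1" "\<And>X. finite X \<Longrightarrow> card X \<le> r \<Longrightarrow> card (on_set X) \<le> m"
    and Z: "finite Z" "card Z \<le> r" and A: "A \<in> K" and D: "D \<subseteq> Pow Z"
  shows "(1 / real m) ^ (2 ^ r) \<le> (\<Prod>X \<in> D. opt_prob A X)"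
proof -
  have "card D \<le> card (Pow Z)" using D Z(1) by (simp add: card_mono)
  also have "\<dots> \<le> 2 ^ r" using Z by (simp add: card_Pow)
  finally have "(1 / real m) ^ (2 ^ r) \<le> (1 / real m) ^ card D"
    using m(1) by (intro power_decreasing) auto
  also have "\<dots> = (\<Prod>X \<in> D. 1 / real m)" by simp
  also have "\<dots> \<le> (\<Prod>X \<in> D. opt_prob A X)"
  proof (rule prod_mono)
    fix X assume "X \<in> D"
    then have X: "finite X" "card X \<le> r"
      using D Z by (auto intro: finite_subset order_trans[OF card_mono])
    have "card (opts A X) \<le> m"
      using card_mono[OF finite_on_set[OF X(1)] opts_subset] m(2)[OF X] by (rule order_trans)
    then show "0 \<le> 1 / real m \<and> 1 / real m \<le> opt_prob A X"
      using opts_card_pos[OF A X(1)] by (auto simp: opt_prob_def intro!: divide_left_mono)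
  qed
  finally show ?thesis .
qed

section \<open>One-point extension axioms and their failure probability\<close>

text \<open>The copy of \<open>B\<close> in which the actual point \<open>a\<close> takes the place
  of the placeholder \<open>v\<close>.\<close>

definition relabel :: "nat \<Rightarrow> nat set \<Rightarrow> ('r, nat) struct \<Rightarrow> nat \<Rightarrow> ('r, nat) struct" where
  "relabel v X B a = Struct (insert a X)
     (\<lambda>R. {xs. set xs \<subseteq> insert a X \<and> map (id(a := v)) xs \<in> interp B R})"

text \<open>\<open>B\<close> prescribes a one-point extension of a base \<open>X\<close> with fewer
  than \<open>r\<close> points. The placeholder \<open>v\<close> for the new point is meant to lie
  outside the universe; on \<open>{..<N}\<close> it is \<open>N\<close>.\<close>

definition extension_property :: "nat \<Rightarrow> nat \<Rightarrow> ('r, nat) struct \<Rightarrow> bool" where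
  "extension_property r v S \<longleftrightarrow>
     (\<forall>X B. X \<subseteq> universe S \<and> card X < r \<and> B \<in> on_set (insert v X) \<and> agree (Pow X) S B \<longrightarrow>
        (\<exists>a \<in> universe S - X. agree (Pow (insert a X)) S (relabel v X B a)))"

lemma relabel_in_K:
  assumes "B \<in> K" "finite X" "v \<notin> X"
  shows "relabel v X B a \<in> K"
  unfolding relabel_def using assms by (intro K_pullback) (auto simp: inj_on_def)

lemma agree_relabel: "a \<notin> X \<Longrightarrow> agree (Pow X) (relabel v X B a) B"
proof -
  assume a: "a \<notin> X"
  have "map (id(a := v)) xs = xs" if "set xs \<subseteq> X" for xs
    using that a by (intro map_idI) auto
  then show ?thesis by (auto simp: agree_def relabel_def)
qed

text \<open>Union bound over at most \<open>(N + 1) ^ r\<close> bases \<open>X\<close> and at most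
  \<open>m\<close> extensions \<open>B\<close> of each. A fixed pair fails only if all of at least
  \<open>N - r\<close> outside points fail.\<close>

lemma extension_property_fails_bound:
  fixes r :: nat
  assumes m: "m \<ge> 1" "\<And>X. finite X \<Longrightarrow> card X \<le> r \<Longrightarrow> card (on_set X) \<le> m"
  shows "(\<Sum>S \<in> {S \<in> on_set {..<N}. \<not> extension_property r N S}. wt S)
    \<le> real m * (real N + 1) ^ r * (1 - (1 / real m) ^ (2 ^ r)) ^ (N - r)"
proof -
  define V where "V = {..<N}"
  define p where "p = (1 / real m) ^ (2 ^ r)"
  define Xs where "Xs = {X. X \<subseteq> V \<and> card X < r}"
  define bad where "bad X B = {S \<in> on_set V. agree (Pow X) S B \<and>
      (\<forall>a \<in> V - X. \<not> agree (Pow (insert a X)) S (relabel N X B a))}" for X B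
  have finV: "finite V" by (simp add: V_def)
  have p: "0 \<le> p" "p \<le> 1" using m(1) unfolding p_def by (auto intro!: power_le_one)
  have finXs: "finite Xs" using finV by (simp add: Xs_def)
  have fX: "finite X" "card X < r" "X \<subseteq> V" "N \<notin> X" if "X \<in> Xs" for X
    using that finV by (auto simp: Xs_def V_def intro: finite_subset)
  have cover: "{S \<in> on_set V. \<not> extension_property r N S} \<subseteq>
      (\<Union>X \<in> Xs. \<Union>B \<in> on_set (insert N X). bad X B)"
  proof
    fix S assume S: "S \<in> {S \<in> on_set V. \<not> extension_property r N S}"
    then have "universe S = V" by (simp add: on_set_def)
    then obtain X B where XB: "X \<subseteq> V" "card X < r" "B \<in> on_set (insert N X)" "agree (Pow X) S B"
      "\<forall>a \<in> V - X. \<not> agree (Pow (insert a X)) S (relabel N X B a)"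
      using S unfolding extension_property_def by auto
    then have "X \<in> Xs" "S \<in> bad X B" using S by (auto simp: Xs_def bad_def)
    then show "S \<in> (\<Union>X \<in> Xs. \<Union>B \<in> on_set (insert N X). bad X B)" using XB(3) by blast
  qed
  have nonneg_bad: "wt S \<ge> 0" if "S \<in> bad X B" for S X B
    using wt_pos[of S] that by (simp add: bad_def on_set_def)
  have fin_ons: "finite (on_set (insert N X))" if "X \<in> Xs" for X
    using fX[OF that] by (intro finite_on_set) simp
  have bad_sub: "bad X B \<subseteq> on_set V" for X B by (auto simp: bad_def)
  have fin_bad: "finite (bad X B)" for X B
    using finite_subset[OF bad_sub finite_on_set[OF finV]] .
  have bad_le: "(\<Sum>S \<in> bad X B. wt S) \<le> (1 - p) ^ (N - r)"
    if X: "X \<in> Xs" and B: "B \<in> on_set (insert N X)" for X B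
  proof -
    have BK: "B \<in> K" using B by (simp add: on_set_def)
    have Ba: "relabel N X B a \<in> K \<and> agree (Pow X) (relabel N X B a) B" if "a \<in> V - X" for a
      using relabel_in_K[OF BK fX(1)[OF X] fX(4)[OF X]] agree_relabel that by blast
    have low: "p \<le> (\<Prod>Y \<in> {Y \<in> Pow (insert a X). a \<in> Y}. opt_prob (relabel N X B a) Y)"
      if "a \<in> V - X" for a
      unfolding p_def
      by (rule prod_opt_prob_lower[OF m, where Z = "insert a X"]) (use fX[OF X] Ba that in auto)
    have "(\<Sum>S \<in> bad X B. wt S) \<le> (1 - p) ^ card (V - X)"
      unfolding bad_def
      by (rule sum_wt_no_extension[OF finV fX(3)[OF X] order_refl BK Ba p(2) low])
    also have "\<dots> \<le> (1 - p) ^ (N - r)"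
    proof (rule power_decreasing)
      have "card (V - X) = N - card X"
        using card_Diff_subset[OF fX(1)[OF X] fX(3)[OF X]] by (simp add: V_def)
      then show "N - r \<le> card (V - X)" using fX(2)[OF X] by simp
    qed (use p in auto)
    finally show ?thesis .
  qed
  have cardXs: "card Xs \<le> (N + 1) ^ r"
  proof -
    let ?L = "{xs. set xs \<subseteq> {..N} \<and> length xs = r}"
    have "Xs \<subseteq> (\<lambda>xs. set xs \<inter> V) ` ?L"
    proof
      fix X assume X: "X \<in> Xs"
      obtain ys where ys: "set ys = X" "distinct ys"
        using finite_distinct_list[OF fX(1)[OF X]] by blast
      \<comment> \<open>A base is coded by a list of length exactly \<open>r\<close>. The padding
        value \<open>N\<close> is outside \<open>V\<close>, so intersecting with \<open>V\<close>
        recovers the base.\<close>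
      define xs where "xs = ys @ replicate (r - length ys) N"
      have "length ys < r" using distinct_card[OF ys(2)] ys(1) fX(2)[OF X] by simp
      then have "xs \<in> ?L" using ys fX(3)[OF X] by (auto simp: xs_def V_def)
      moreover have "set xs \<inter> V = X" using ys fX(3)[OF X] by (auto simp: xs_def V_def)
      ultimately show "X \<in> (\<lambda>xs. set xs \<inter> V) ` ?L" by blast
    qed
    then have "card Xs \<le> card ?L"
      by (rule surj_card_le[rotated]) (simp add: finite_lists_length_eq)
    also have "\<dots> = (N + 1) ^ r" by (simp add: card_lists_length_eq)
    finally show ?thesis .
  qed
  have "(\<Sum>S \<in> {S \<in> on_set V. \<not> extension_property r N S}. wt S) \<le>
      (\<Sum>S \<in> (\<Union>X \<in> Xs. \<Union>B \<in> on_set (insert N X). bad X B). wt S)"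
    using cover finXs fin_ons fin_bad by (intro sum_mono2) (auto intro: nonneg_bad)
  also have "\<dots> \<le> (\<Sum>X \<in> Xs. \<Sum>S \<in> (\<Union>B \<in> on_set (insert N X). bad X B). wt S)"
    using finXs fin_ons fin_bad by (intro sum_UNION_le) (auto intro: nonneg_bad)
  also have "\<dots> \<le> (\<Sum>X \<in> Xs. real m * (1 - p) ^ (N - r))"
  proof (rule sum_mono)
    fix X assume X: "X \<in> Xs"
    have "(\<Sum>S \<in> (\<Union>B \<in> on_set (insert N X). bad X B). wt S) \<le>
        (\<Sum>B \<in> on_set (insert N X). \<Sum>S \<in> bad X B. wt S)"
      using fin_ons[OF X] fin_bad by (intro sum_UNION_le) (auto intro: nonneg_bad)
    also have "\<dots> \<le> (\<Sum>B \<in> on_set (insert N X). (1 - p) ^ (N - r))"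
      by (intro sum_mono bad_le[OF X])
    also have "\<dots> = real (card (on_set (insert N X))) * (1 - p) ^ (N - r)" by simp
    also have "\<dots> \<le> real m * (1 - p) ^ (N - r)"
      using m(2)[of "insert N X"] fX[OF X] p by (intro mult_right_mono) auto
    finally show "(\<Sum>S \<in> (\<Union>B \<in> on_set (insert N X). bad X B). wt S) \<le> real m * (1 - p) ^ (N - r)" .
  qed
  also have "\<dots> = real (card Xs) * (real m * (1 - p) ^ (N - r))" by simp
  also have "\<dots> \<le> (real N + 1) ^ r * (real m * (1 - p) ^ (N - r))"
  proof (rule mult_right_mono)
    have "real (card Xs) \<le> real ((N + 1) ^ r)" using cardXs by (simp only: of_nat_le_iff)
    then show "real (card Xs) \<le> (real N + 1) ^ r" by (simp add: add.commute)
  qed (use p in auto)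
  finally show ?thesis by (simp add: V_def p_def mult_ac)
qed

lemma extension_property_almost_surely:
  "(\<lambda>N. \<Sum>S \<in> {S \<in> on_set {..<N}. \<not> extension_property r N S}. wt S) \<longlonglongrightarrow> 0"
proof -
  obtain m where m: "m \<ge> 1" "\<And>X. finite X \<Longrightarrow> card X \<le> r \<Longrightarrow> card (on_set X) \<le> m"
    using on_set_bound[of r] by blast
  define c where "c = 1 - (1 / real m) ^ (2 ^ r)"
  have c: "0 \<le> c" "c < 1" using m(1) by (auto simp: c_def power_le_one)
  have lim: "(\<lambda>N. real m * (real N + 1) ^ r * c ^ (N - r)) \<longlonglongrightarrow> 0"
    using polynomial_times_power_tendsto_0[OF c, of r] by (simp add: mult.assoc tendsto_mult_right_zero)
  show ?thesis
  proof (rule tendsto_sandwich[OF _ _ tendsto_const lim]; intro always_eventually allI)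
    show "0 \<le> (\<Sum>S \<in> {S \<in> on_set {..<N}. \<not> extension_property r N S}. wt S)" for N
      using wt_pos by (intro sum_nonneg) (force simp: on_set_def)
    show "(\<Sum>S \<in> {S \<in> on_set {..<N}. \<not> extension_property r N S}. wt S)
        \<le> real m * (real N + 1) ^ r * c ^ (N - r)" for N
      unfolding c_def by (rule extension_property_fails_bound[OF m])
  qed
qed

end

lemma embedding_induced:
  assumes "embedding \<Sigma> S F g" "Y \<subseteq> universe S"
  shows "embedding \<Sigma> (induced S Y) F g"
proof -
  have "xs \<in> interp S R \<longleftrightarrow> map g xs \<in> interp F R"
    if "R \<in> symbols \<Sigma>" "set xs \<subseteq> Y" "length xs = arity \<Sigma> R" for R xs
    using assms that subset_trans unfolding embedding_def by blast
  moreover have "inj_on g Y" "g ` Y \<subseteq> universe F"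
    using assms unfolding embedding_def by (auto intro: inj_on_subset)
  ultimately show ?thesis
    using assms(2) unfolding embedding_def induced_def by (simp add: inf.absorb2)
qed

section \<open>Back and forth\<close>

primrec quantifier_rank :: "'r form \<Rightarrow> nat" where
  "quantifier_rank Falsum = 0"
| "quantifier_rank (Eq i j) = 0"
| "quantifier_rank (Rel R is) = 0"
| "quantifier_rank (Neg p) = quantifier_rank p"
| "quantifier_rank (Conj p q) = max (quantifier_rank p) (quantifier_rank q)"
| "quantifier_rank (Disj p q) = max (quantifier_rank p) (quantifier_rank q)"
| "quantifier_rank (Imp p q) = max (quantifier_rank p) (quantifier_rank q)"
| "quantifier_rank (Forall i p) = Suc (quantifier_rank p)"
| "quantifier_rank (Exists i p) = Suc (quantifier_rank p)"

text \<open>What back and forth uses of the limit: its finite substructures belong to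
  \<open>K\<close> up to renaming, stated here as literal membership, and partial embeddings of
  members of \<open>K\<close> extend.\<close>

locale framed_limit = framed_class \<Sigma> K for \<Sigma> :: "'r signature" and K +
  fixes F :: "('r, 'a) struct"
  assumes F_structure: "is_structure \<Sigma> F"
    and F_age: "is_structure \<Sigma> B \<Longrightarrow> finite (universe B) \<Longrightarrow> embedding \<Sigma> B F g \<Longrightarrow> B \<in> K"
    and F_extend: "B \<in> K \<Longrightarrow> X \<subseteq> universe B \<Longrightarrow> embedding \<Sigma> (induced B X) F f \<Longrightarrow>
          \<exists>g. embedding \<Sigma> B F g \<and> (\<forall>x \<in> X. g x = f x)"
begin

text \<open>Drops the side conditions on symbol and length from \<open>embedding\<close>: an
  ill-formed tuple holds on neither side.\<close>

lemma embedding_interp_iff: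
  assumes "S \<in> K" "embedding \<Sigma> (induced S X) F h" "X \<subseteq> universe S" "set xs \<subseteq> X"
  shows "xs \<in> interp S R \<longleftrightarrow> map h xs \<in> interp F R"
proof (cases "R \<in> symbols \<Sigma> \<and> length xs = arity \<Sigma> R")
  case True
  then show ?thesis using assms(2-4) unfolding embedding_def induced_def by auto
next
  case False
  then have "map h xs \<notin> interp F R"
    using F_structure unfolding is_structure_def by (metis empty_iff length_map)
  moreover have "xs \<notin> interp S R" using False K_interp(1,2)[OF assms(1)] by blast
  ultimately show ?thesis by simp
qed

lemma embeddingI:
  assumes "X \<subseteq> universe S" "inj_on h X" "h ` X \<subseteq> universe F"
    "\<And>R xs. set xs \<subseteq> X \<Longrightarrow> xs \<in> interp S R \<longleftrightarrow> map h xs \<in> interp F R"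
  shows "embedding \<Sigma> (induced S X) F h"
  unfolding embedding_def induced_def using assms by (simp add: inf.absorb2)

text \<open>Homogeneity of \<open>F\<close> extends \<open>h\<close> to all of the finite structure
  \<open>S\<close>, in particular to \<open>a\<close>.\<close>

lemma extend_forth:
  assumes S: "S \<in> K" and X: "X \<subseteq> universe S" and h: "embedding \<Sigma> (induced S X) F h"
    and a: "a \<in> universe S"
  obtains g where "embedding \<Sigma> (induced S (insert a X)) F g" "\<forall>x \<in> X. g x = h x"
    "g a \<in> universe F"
proof -
  obtain g where g: "embedding \<Sigma> S F g" "\<forall>x \<in> X. g x = h x" using F_extend[OF S X h] by blast
  have "embedding \<Sigma> (induced S (insert a X)) F g"
    using embedding_induced[OF g(1)] X a by simp
  moreover have "g a \<in> universe F" using g(1) a by (auto simp: embedding_def)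
  ultimately show ?thesis using that g(2) by blast
qed

text \<open>If \<open>b\<close> is new, it prescribes a one-point extension of \<open>X\<close>,
  which lies in \<open>K\<close> since it embeds in \<open>F\<close>. The extension property finds a
  point of \<open>S\<close> realising it.\<close>

lemma extend_back:
  assumes S: "S \<in> K" and X: "X \<subseteq> universe S" and h: "embedding \<Sigma> (induced S X) F h"
    and ext: "extension_property r v S" "card X < r" "v \<notin> universe S" and b: "b \<in> universe F"
  obtains a g where "a \<in> universe S" "embedding \<Sigma> (induced S (insert a X)) F g"
    "\<forall>x \<in> X. g x = h x" "g a = b"
proof (cases "b \<in> h ` X")
  case True
  then obtain a where a: "a \<in> X" "b = h a" by auto
  then have "insert a X = X" by auto
  then show ?thesis using that[of a h] a h X by auto
next
  case False
  have inj: "inj_on h X" and img: "h ` X \<subseteq> universe F"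
    using h X by (auto simp: embedding_def induced_def inf.absorb2)
  have vX: "v \<notin> X" using ext(3) X by auto
  define h' where "h' = h(v := b)"
  \<comment> \<open>The relations of \<open>F\<close> are pulled back along \<open>h\<close> with
    the placeholder \<open>v\<close> sent to \<open>b\<close>.\<close>
  define B where "B = Struct (insert v X) (\<lambda>R. {xs. set xs \<subseteq> insert v X \<and> map h' xs \<in> interp F R})"
  have finX: "finite X" using finite_subset[OF X K_finite[OF S]] .
  have B_struct: "is_structure \<Sigma> B"
    using F_structure unfolding is_structure_def B_def by fastforce
  have inj': "inj_on h' (insert v X)"
    using inj vX False by (auto simp: h'_def inj_on_def)
  have "embedding \<Sigma> B F h'"
    using inj' img b by (auto simp: embedding_def B_def h'_def)
  then have "B \<in> K" using F_age[OF B_struct] finX by (simp add: B_def)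
  then have B: "B \<in> on_set (insert v X)" by (simp add: on_set_def B_def)
  have "agree (Pow X) S B"
  proof -
    have "xs \<in> interp S R \<longleftrightarrow> xs \<in> interp B R" if xs: "set xs \<subseteq> X" for xs R
    proof -
      have "map h' xs = map h xs" using xs vX by (auto simp: h'_def)
      then show ?thesis using embedding_interp_iff[OF S h X xs] xs
        by (auto simp: B_def simp del: map_eq_conv)
    qed
    then show ?thesis by (auto simp: agree_def)
  qed
  then obtain a where a: "a \<in> universe S - X" "agree (Pow (insert a X)) S (relabel v X B a)"
    using ext(1,2) X B unfolding extension_property_def by blast
  define g where "g = h(a := b)"
  have gX: "\<forall>x \<in> X. g x = h x" using a(1) by (auto simp: g_def)
  have "embedding \<Sigma> (induced S (insert a X)) F g"
  proof (rule embeddingI)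
    show "insert a X \<subseteq> universe S" using a(1) X by auto
    show "inj_on g (insert a X)" using inj a(1) False by (auto simp: g_def inj_on_def)
    show "g ` insert a X \<subseteq> universe F" using img b a(1) by (auto simp: g_def)
    fix R xs assume xs: "set xs \<subseteq> insert a X"
    have 1: "set (map (id(a := v)) xs) \<subseteq> insert v X" using xs by auto
    have 2: "map h' (map (id(a := v)) xs) = map g xs"
      using xs vX by (auto simp: h'_def g_def)
    have "xs \<in> interp S R \<longleftrightarrow> xs \<in> interp (relabel v X B a) R"
      using a(2) xs by (auto simp: agree_def)
    also have "\<dots> \<longleftrightarrow> map (id(a := v)) xs \<in> interp B R" using xs by (simp add: relabel_def)
    also have "\<dots> \<longleftrightarrow> map h' (map (id(a := v)) xs) \<in> interp F R"
      using 1 by (simp only: B_def struct.sel mem_Collect_eq simp_thms)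
    finally show "xs \<in> interp S R \<longleftrightarrow> map g xs \<in> interp F R" unfolding 2 .
  qed
  then show ?thesis using that[of a g] a(1) gX by (auto simp: g_def)
qed

text \<open>The invariant is \<open>card X + quantifier_rank p \<le> r\<close>: each quantifier
  costs one rank and adds at most one point to the domain of the partial embedding.\<close>

lemma back_and_forth:
  assumes S: "S \<in> K" and ext: "extension_property r v S" "v \<notin> universe S"
  shows "form_over \<Sigma> p \<Longrightarrow> X \<subseteq> universe S \<Longrightarrow> embedding \<Sigma> (induced S X) F h \<Longrightarrow>
    card X + quantifier_rank p \<le> r \<Longrightarrow> e ` free_vars p \<subseteq> X \<Longrightarrow> sat S e p \<longleftrightarrow> sat F (h \<circ> e) p"
proof (induction p arbitrary: X h e)
  case (Eq i j)
  then have "inj_on h X" by (simp add: embedding_def induced_def inf.absorb2)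
  then show ?case using Eq.prems(5) by (auto simp: inj_on_def)
next
  case (Rel R xs)
  then show ?case using embedding_interp_iff[OF S Rel.prems(3,2), of "map e xs" R]
    by (simp add: comp_def)
next
  case (Forall i p)
  have step: "sat S (e(i := a)) p \<longleftrightarrow> sat F ((h \<circ> e)(i := g a)) p"
    if "a \<in> universe S" "embedding \<Sigma> (induced S (insert a X)) F g" "\<forall>x \<in> X. g x = h x" for a g
  proof -
    have "card (insert a X) \<le> Suc (card X)" by (rule card_insert_le_m1) auto
    then have "sat S (e(i := a)) p \<longleftrightarrow> sat F (g \<circ> e(i := a)) p"
      using Forall.prems that by (intro Forall.IH[of "insert a X"]) auto
    also have "\<dots> \<longleftrightarrow> sat F ((h \<circ> e)(i := g a)) p"
      using that(3) Forall.prems(5) by (intro sat_cong) auto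
    finally show ?thesis .
  qed
  \<comment> \<open>The quantifier at hand leaves room for one more point, as
    \<open>extension_property\<close> requires.\<close>
  have lt: "card X < r" using Forall.prems(4) by simp
  show ?case
  proof
    assume L: "sat S e (Forall i p)"
    have "sat F ((h \<circ> e)(i := b)) p" if "b \<in> universe F" for b
      using extend_back[OF S Forall.prems(2,3) ext(1) lt ext(2) that] step L by (metis sat.simps(8))
    then show "sat F (h \<circ> e) (Forall i p)" by simp
  next
    assume R: "sat F (h \<circ> e) (Forall i p)"
    have "sat S (e(i := a)) p" if "a \<in> universe S" for a
      using extend_forth[OF S Forall.prems(2,3) that] step[OF that] R by (metis sat.simps(8))
    then show "sat S e (Forall i p)" by simp
  qed
next
  case (Exists i p)
  have step: "sat S (e(i := a)) p \<longleftrightarrow> sat F ((h \<circ> e)(i := g a)) p"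
    if "a \<in> universe S" "embedding \<Sigma> (induced S (insert a X)) F g" "\<forall>x \<in> X. g x = h x" for a g
  proof -
    have "card (insert a X) \<le> Suc (card X)" by (rule card_insert_le_m1) auto
    then have "sat S (e(i := a)) p \<longleftrightarrow> sat F (g \<circ> e(i := a)) p"
      using Exists.prems that by (intro Exists.IH[of "insert a X"]) auto
    also have "\<dots> \<longleftrightarrow> sat F ((h \<circ> e)(i := g a)) p"
      using that(3) Exists.prems(5) by (intro sat_cong) auto
    finally show ?thesis .
  qed
  have lt: "card X < r" using Exists.prems(4) by simp
  show ?case
  proof
    assume "sat S e (Exists i p)"
    then obtain a where a: "a \<in> universe S" "sat S (e(i := a)) p" by auto
    then show "sat F (h \<circ> e) (Exists i p)"
      using extend_forth[OF S Exists.prems(2,3) a(1)] step[OF a(1)] by (metis sat.simps(9))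
  next
    assume "sat F (h \<circ> e) (Exists i p)"
    then obtain b where b: "b \<in> universe F" "sat F ((h \<circ> e)(i := b)) p" by auto
    then show "sat S e (Exists i p)"
      using extend_back[OF S Exists.prems(2,3) ext(1) lt ext(2) b(1)] step by (metis sat.simps(9))
  qed
qed (auto simp: image_Un)

lemma extension_property_models_iff:
  assumes "S \<in> K" "extension_property (quantifier_rank p) v S" "v \<notin> universe S" "sentence \<Sigma> p"
  shows "S \<TTurnstile> p \<longleftrightarrow> F \<TTurnstile> p"
proof -
  fix h :: "nat \<Rightarrow> 'a" and e :: "nat \<Rightarrow> nat"
  \<comment> \<open>The game starts from the empty map, which is an embedding because there are no
    nullary relations.\<close>
  have "embedding \<Sigma> (induced S {}) F h"
    by (auto simp: embedding_def induced_def dest: arity_pos)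
  then have "sat S e p \<longleftrightarrow> sat F (h \<circ> e) p"
    using assms by (intro back_and_forth[OF assms(1-3)]) (auto simp: sentence_def)
  then show ?thesis
    using models_sentence[OF assms(4), of S e] models_sentence[OF assms(4), of F "h \<circ> e"] by simp
qed

text \<open>Outside \<open>bad N\<close> a structure agrees with \<open>F\<close> on the sentence.
  The event thus contains the complement of \<open>bad N\<close> or is contained in
  \<open>bad N\<close>, whose weight tends to 0.\<close>

lemma zero_one_law:
  assumes \<phi>: "sentence \<Sigma> \<phi>"
  shows "(\<lambda>N. \<Sum>S \<in> {S \<in> on_set {..<N}. S \<TTurnstile> \<phi>}. wt S) \<longlonglongrightarrow> (if F \<TTurnstile> \<phi> then 1 else 0)"
proof -
  define bad where "bad N = {S \<in> on_set {..<N}. \<not> extension_property (quantifier_rank \<phi>) N S}" for N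
  define E where "E N = {S \<in> on_set {..<N}. S \<TTurnstile> \<phi>}" for N
  have bad0: "(\<lambda>N. \<Sum>S \<in> bad N. wt S) \<longlonglongrightarrow> 0"
    unfolding bad_def by (rule extension_property_almost_surely)
  have good: "S \<TTurnstile> \<phi> \<longleftrightarrow> F \<TTurnstile> \<phi>" if "S \<in> on_set {..<N} - bad N" for S N
    using extension_property_models_iff[of S \<phi> N] \<phi> that by (auto simp: bad_def on_set_def)
  have fin: "finite (on_set {..<N})" for N by (simp add: finite_on_set)
  have nonneg: "wt S \<ge> 0" if "S \<in> on_set {..<N}" for S N
    using wt_pos[of S] that by (simp add: on_set_def)
  have mono: "(\<Sum>S \<in> A. wt S) \<le> (\<Sum>S \<in> bad N. wt S)" if "A \<subseteq> bad N" for A N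
    using that fin by (intro sum_mono2) (auto simp: bad_def intro: nonneg)
  have ge0: "(\<Sum>S \<in> E N. wt S) \<ge> 0" for N
    by (intro sum_nonneg) (auto simp: E_def intro: nonneg)
  show ?thesis
  proof (cases "F \<TTurnstile> \<phi>")
    case True
    have lower: "1 - (\<Sum>S \<in> bad N. wt S) \<le> (\<Sum>S \<in> E N. wt S)" and upper: "(\<Sum>S \<in> E N. wt S) \<le> 1" for N
    proof -
      have split: "(\<Sum>S \<in> on_set {..<N} - E N. wt S) = 1 - (\<Sum>S \<in> E N. wt S)"
        using sum_diff[OF fin, of "E N" N wt] sum_wt_on_set[of "{..<N}"] by (auto simp: E_def)
      have "on_set {..<N} - E N \<subseteq> bad N" using good True by (auto simp: E_def)
      then show "1 - (\<Sum>S \<in> bad N. wt S) \<le> (\<Sum>S \<in> E N. wt S)"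
        using mono[of "on_set {..<N} - E N" N] split by linarith
      have "(\<Sum>S \<in> on_set {..<N} - E N. wt S) \<ge> 0" by (intro sum_nonneg) (auto intro: nonneg)
      then show "(\<Sum>S \<in> E N. wt S) \<le> 1" using split by linarith
    qed
    have "(\<lambda>N. 1 - (\<Sum>S \<in> bad N. wt S)) \<longlonglongrightarrow> 1"
      using tendsto_diff[OF tendsto_const[of 1] bad0] by simp
    then have "(\<lambda>N. \<Sum>S \<in> E N. wt S) \<longlonglongrightarrow> 1"
      by (rule tendsto_sandwich[OF _ _ _ tendsto_const, rotated 2]) (auto simp: lower upper)
    then show ?thesis using True by (simp add: E_def)
  next
    case False
    have "E N \<subseteq> bad N" for N using good False by (auto simp: E_def)
    then have "(\<lambda>N. \<Sum>S \<in> E N. wt S) \<longlonglongrightarrow> 0"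
      by (intro tendsto_sandwich[OF _ _ tendsto_const bad0]) (auto simp: ge0 mono)
    then show ?thesis using False by (simp add: E_def)
  qed
qed

end

section \<open>Fraisse limits of local classes\<close>

lemma isomorphic_imp_embeddable:
  assumes "isomorphic \<Sigma> A B" "embeddable \<Sigma> B C"
  shows "embeddable \<Sigma> A C"
proof -
  obtain f g where f: "embedding \<Sigma> A B f" and g: "embedding \<Sigma> B C g"
    using assms by (auto simp: isomorphic_def embeddable_def)
  have "inj_on (g \<circ> f) (universe A)"
    using f g by (auto simp: embedding_def intro: comp_inj_on inj_on_subset)
  moreover have "(g \<circ> f) ` universe A \<subseteq> universe C"
    using f g by (auto simp: embedding_def image_subset_iff)
  moreover have "xs \<in> interp A R \<longleftrightarrow> map (g \<circ> f) xs \<in> interp C R"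
    if R: "R \<in> symbols \<Sigma>" and xs: "set xs \<subseteq> universe A" "length xs = arity \<Sigma> R" for R xs
  proof -
    have "set (map f xs) \<subseteq> universe B" using f xs(1) by (auto simp: embedding_def)
    then have "map f xs \<in> interp B R \<longleftrightarrow> map g (map f xs) \<in> interp C R"
      using g R xs(2) unfolding embedding_def by (metis length_map)
    moreover have "xs \<in> interp A R \<longleftrightarrow> map f xs \<in> interp B R"
      using f R xs unfolding embedding_def by blast
    ultimately show ?thesis by simp
  qed
  ultimately show ?thesis unfolding embeddable_def embedding_def by blast
qed

lemma fraisse_limit_embeddable:
  assumes "fraisse_limit \<Sigma> K F" "M \<in> K"
  shows "embeddable \<Sigma> M F"
proof -
  obtain B where "B \<in> age \<Sigma> F" "isomorphic \<Sigma> M B"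
    using assms unfolding fraisse_limit_def by blast
  then show ?thesis by (intro isomorphic_imp_embeddable[of \<Sigma> M B F]) (auto simp: age_def)
qed

text \<open>Two empty structures that differ in a nullary relation would both lie in the local class,
  but cannot both embed into the limit.\<close>

lemma fraisse_limit_arity_pos:
  assumes "local_class \<Sigma> K" "fraisse_limit \<Sigma> K F" "R \<in> symbols \<Sigma>"
  shows "arity \<Sigma> R > 0"
proof (rule ccontr)
  assume "\<not> arity \<Sigma> R > 0"
  then have R: "arity \<Sigma> R = 0" by simp
  obtain \<Phi> where \<Phi>: "\<forall>p \<in> \<Phi>. local_sentence \<Sigma> p" "K = Mod \<Sigma> \<Phi>"
    using assms(1) unfolding local_class_def by blast
  have *: "[] \<in> I R \<longleftrightarrow> [] \<in> interp F R" if "is_structure \<Sigma> (Struct {} I)" for I :: "'a \<Rightarrow> nat list set"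
  proof -
    have "Struct {} I \<in> K" using empty_in_Mod[OF \<Phi>(1) that] by (simp add: \<Phi>(2))
    then obtain f where "embedding \<Sigma> (Struct {} I) F f"
      using fraisse_limit_embeddable[OF assms(2)] by (auto simp: embeddable_def)
    then show ?thesis using assms(3) R by (force simp: embedding_def)
  qed
  have "is_structure \<Sigma> (Struct {} (\<lambda>_. {} :: nat list set))"
    "is_structure \<Sigma> (Struct {} (\<lambda>R'. if R' = R then {[] :: nat list} else {}))"
    using assms(3) R by (auto simp: is_structure_def split: if_splits)
  from this[THEN *] show False by simp
qed

lemma framed_class_local_class:
  assumes "local_class \<Sigma> K" "\<And>R. R \<in> symbols \<Sigma> \<Longrightarrow> arity \<Sigma> R > 0"
  shows "framed_class \<Sigma> K"
proof -
  obtain \<Phi> where \<Phi>: "general_irreflexivity \<Sigma> \<subseteq> \<Phi>" "\<forall>p \<in> \<Phi>. local_sentence \<Sigma> p"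
    and K: "K = Mod \<Sigma> \<Phi>" and lf: "locally_finite \<Sigma>"
    using assms(1) unfolding local_class_def by blast
  show ?thesis
  proof
    show "finite {R \<in> symbols \<Sigma>. arity \<Sigma> R = n}" for n using lf by (simp add: locally_finite_def)
    show "arity \<Sigma> R > 0" if "R \<in> symbols \<Sigma>" for R by (rule assms(2)[OF that])
    show "is_structure \<Sigma> S" "finite (universe S)" if "S \<in> K" for S
      using that by (auto simp: K Mod_def)
    show "distinct xs" if "S \<in> K" "xs \<in> interp S R" for S xs R
      using Mod_distinct[OF \<Phi>(1)] that by (simp add: K)
    show "M \<in> K" if "is_structure \<Sigma> M" "finite (universe M)"
      "\<And>R xs. xs \<in> interp M R \<Longrightarrow> \<exists>A \<in> K. \<exists>f. inj_on f (set xs) \<and>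
           (\<forall>R' zs. set zs \<subseteq> set xs \<longrightarrow> (zs \<in> interp M R' \<longleftrightarrow> map f zs \<in> interp A R'))" for M
      using Mod_local[OF \<Phi>(2) that(1,2)] that(3) by (simp add: K)
  qed
qed

text \<open>The age is given only up to isomorphism, so its members are pulled back along the
  isomorphism to land in \<open>K\<close> itself; extension of embeddings is weak
  homogeneity.\<close>

lemma framed_limit_fraisse_limit:
  assumes K: "local_class \<Sigma> K" and F: "fraisse_limit \<Sigma> K F"
  shows "framed_limit \<Sigma> K F"
proof -
  interpret framed_class \<Sigma> K
    by (intro framed_class_local_class[OF K] fraisse_limit_arity_pos[OF K F])
  show ?thesis
  proof
    show "is_structure \<Sigma> F" using F by (simp add: fraisse_limit_def)
    show "B \<in> K" if B: "is_structure \<Sigma> B" "finite (universe B)" "embedding \<Sigma> B F g" for B g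
    proof -
      have "B \<in> age \<Sigma> F" using B by (auto simp: age_def embeddable_def)
      then obtain M f where M: "M \<in> K" and f: "embedding \<Sigma> B M f"
        using F unfolding fraisse_limit_def isomorphic_def by blast
      have *: "zs \<in> interp B R \<longleftrightarrow> set zs \<subseteq> universe B \<and> map f zs \<in> interp M R" for zs R
      proof (cases "R \<in> symbols \<Sigma> \<and> length zs = arity \<Sigma> R \<and> set zs \<subseteq> universe B")
        case True
        then show ?thesis using f by (auto simp: embedding_def)
      next
        case False
        then show ?thesis
          using B(1) K_interp(1,2)[OF M, of "map f zs" R] by (auto simp: is_structure_def)
      qed
      \<comment> \<open>\<open>B\<close> equals the pullback of its isomorphic copy
        \<open>M\<close>, and pullbacks stay in \<open>K\<close>.\<close>
      have "Struct (universe B) (\<lambda>R. {xs. set xs \<subseteq> universe B \<and> map f xs \<in> interp M R}) \<in> K"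
        using f by (intro K_pullback[OF M B(2)]) (simp add: embedding_def)
      moreover have "B = Struct (universe B) (\<lambda>R. {xs. set xs \<subseteq> universe B \<and> map f xs \<in> interp M R})"
        using * by (cases B) (auto simp: fun_eq_iff)
      ultimately show ?thesis by simp
    qed
    show "\<exists>g. embedding \<Sigma> B F g \<and> (\<forall>x \<in> X. g x = f x)"
      if B: "B \<in> K" "X \<subseteq> universe B" "embedding \<Sigma> (induced B X) F f" for B X f
    proof -
      have "B \<in> age \<Sigma> F"
        using fraisse_limit_embeddable[OF F B(1)] K_structure K_finite B(1) by (simp add: age_def)
      moreover have "universe (induced B X) = X" using B(2) by (auto simp: induced_def)
      moreover from this have "substructure (induced B X) B" using B(2) by (simp add: substructure_def)
      ultimately show ?thesis
        using F B(3) unfolding fraisse_limit_def weakly_homogeneous_def by metis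
    qed
  qed
qed

theorem theorem5p11:
  fixes \<Sigma> :: "'r signature"
    and K :: "('r, nat) struct set"
    and F :: "('r, 'a) struct"
    and \<phi> :: "'r form"
  assumes "locally_finite \<Sigma>"
    and "local_class \<Sigma> K"
    and "fraisse_limit \<Sigma> K F"
    and "sentence \<Sigma> \<phi>"
  shows "(\<lambda>N. measure (framewise_uniform \<Sigma> K N) {S \<in> on_size K N. S \<TTurnstile> \<phi>})
           \<longlonglongrightarrow> (if F \<TTurnstile> \<phi> then 1 else 0)"
proof -
  interpret framed_limit \<Sigma> K F by (rule framed_limit_fraisse_limit[OF assms(2,3)])
  have "measure (framewise_uniform \<Sigma> K N) {S \<in> on_size K N. S \<TTurnstile> \<phi>} =
      (\<Sum>S \<in> {S \<in> on_set {..<N}. S \<TTurnstile> \<phi>}. wt S)" for N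
    unfolding on_size_eq_on_set by (rule framewise_uniform_measure) auto
  then show ?thesis using zero_one_law[OF assms(4)] by simp
qed

end
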